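(* Let $\{(\xi_l,\overline{\xi}_l)\}_{l\in\mathbb Z}$ be an i.i.d. sequence of zero-mean random vectors in $\mathbb R^2$ such that $E[\xi_1^2]<\infty$, $E[\overline{\xi}_1^2]<\infty$ and $\sup_{t\ge 0}t^{\alpha}P(|\xi_1\overline{\xi}_1|>t)<\infty$ for some $\alpha>1$. Let $(c_l)_{l\in\mathbb Z}$, $(\overline c_l)_{l\in\mathbb Z}$ be real sequences satisfying $$\sup_{l\in\mathbb Z}|l|^{\sigma}|c_l|<\infty,\qquad \sup_{l\in\mathbb Z}|l|^{\overline{\sigma}}|\overline c_l|<\infty\quad\text{for some }\sigma,\overline{\sigma}\in\left(\tfrac12,1\right].$$ Define $d_k=\sum_{l,m=-\infty}^{\infty}c_{k-l}\overline c_{k-m}\xi_l\overline{\xi}_m$ and $d=E[\xi_1\overline{\xi}_1]\sum_{l=-\infty}^{\infty}c_l\overline c_l$. Then for every $p$ satisfying $p<\frac{1}{2-\sigma-\overline{\sigma}}\wedge\alpha\wedge 2$, $$\lim_{n\to\infty}\frac{1}{n^{1/p}}\sum_{k=1}^{n}(d_k-d)=0\quad\text{almost surely.}$$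
   Context: $a\wedge b=\min\{a,b\}$. All random variables are defined on a common probability space. *)

theory Defs
  imports "HOL-Probability.Probability"
begin

definition dseq :: "(int \<Rightarrow> real) \<Rightarrow> (int \<Rightarrow> real) \<Rightarrow> (int \<Rightarrow> 'a \<Rightarrow> real) \<Rightarrow> (int \<Rightarrow> 'a \<Rightarrow> real)
    \<Rightarrow> int \<Rightarrow> 'a \<Rightarrow> real" where
  "dseq c cbar \<xi> \<xi>bar k \<omega> =
     lim (\<lambda>N::nat. \<Sum>l\<in>{- int N..int N}. \<Sum>m\<in>{- int N..int N}.
            c (k - l) * cbar (k - m) * \<xi> l \<omega> * \<xi>bar m \<omega>)"

end

theory Submission
  imports Defs "HOL-Real_Asymp.Real_Asymp"
begin

text \<open>
  Almost surely \<open>d\<^sub>k\<close> is the product of two convergent linear processes, and \<open>d\<^sub>k - d\<close> splits into a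
  diagonal part \<open>l = m\<close> and an off-diagonal part \<open>l \<noteq> m\<close>. The diagonal part is a linear process with
  absolutely summable weights driven by centred variables with a finite \<open>q\<close>-th moment for some
  \<open>q > p\<close>, so by a von Bahr--Esseen inequality its sums over windows of length \<open>n\<close> have \<open>q\<close>-th moment
  \<open>O(n)\<close>. The off-diagonal part only involves second moments: its window sums have second moment
  at most a constant times \<open>\<Sum>\<^sub>l\<^sub>,\<^sub>m (\<Sum>\<^sub>k c (k - l) cbar (k - m))\<^sup>2 = O(n\<^sup>\<gamma>)\<close> for every
  \<open>\<gamma> > max 1 (2 (2 - \<sigma> - \<sigma>bar))\<close>, and \<open>\<gamma>\<close> can be taken smaller than \<open>2 / p\<close>. In both cases
  dyadic chaining and a Borel--Cantelli argument turn the moment bound into the almost sure rate.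
\<close>

subsection \<open>Elementary inequalities\<close>

text \<open>The split is forced by moments. \<open>\<xi> l\<close> and \<open>\<xi>bar l\<close> may
  depend on each other, so the variance of their product may be infinite and the tail condition only
  yields moments of order below \<open>\<alpha>\<close>. For \<open>l \<noteq> m\<close> the factors
  are independent and the product has a second moment. On the diagonal, weights of decay
  \<open>\<sigma> + \<sigma>bar > 1\<close> make up for the weak moments. Off the diagonal neither
  sequence need be absolutely summable, and cancellation must help: once the indices are ordered,
  the larger one carries a centred factor and the smaller ones are its past, so the form is a
  martingale transform.

  The exponent \<open>2 (2 - \<sigma> - \<sigma>bar)\<close> arises as follows. Weights of order
  \<open>\<bar>l\<bar> powr (- \<sigma>)\<close>, correlated with themselves at lag
  \<open>h\<close>, give \<open>\<bar>h\<bar> powr (- (2 * \<sigma> - 1))\<close> up to an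
  arbitrarily small loss; two such factors, summed over the pairs of a window, leave the power
  \<open>2 - (2 * \<sigma> - 1) - (2 * \<sigma>bar - 1)\<close> of \<open>n\<close>.

  Moment bounds are proved for truncations to \<open>{- N..N}\<close>, uniformly in
  \<open>N\<close>, and reach the limits by Fatou.\<close>

lemma powr_add_subadditive:
  fixes a b s :: real
  assumes "0 \<le> a" "0 \<le> b" "0 < s" "s \<le> 1"
  shows "(a + b) powr s \<le> a powr s + b powr s"
proof (cases "a + b = 0")
  case True
  then show ?thesis using assms by simp
next
  case False
  define t where "t = a + b"
  have t: "t > 0" using False assms by (simp add: t_def)
  \<comment> \<open>A fraction \<open>x / t\<close> in the unit interval does not shrink when raised
    to a power \<open>s \<le> 1\<close>. This is applied to \<open>a / t\<close> and
    \<open>b / t\<close>, which add up to one.\<close>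
  have *: "t powr s * (x / t) \<le> x powr s" if "0 \<le> x" "x \<le> t" for x
  proof (cases "x = 0")
    case False
    have "(x / t) powr 1 \<le> (x / t) powr s"
      using that t assms False by (intro powr_mono') auto
    hence "t powr s * (x / t) \<le> t powr s * (x / t) powr s"
      using that t by (intro mult_left_mono) auto
    also have "\<dots> = x powr s"
      using that t by (simp add: powr_divide)
    finally show ?thesis .
  qed simp
  have "t powr s = t powr s * (a / t) + t powr s * (b / t)"
    using t by (simp add: t_def flip: distrib_left add_divide_distrib)
  also have "\<dots> \<le> a powr s + b powr s"
    using assms by (intro add_mono *) (auto simp: t_def)
  finally show ?thesis by (simp add: t_def)
qed

text \<open>Hoelder continuity of the signed power, needed for \<open>s = q - 1\<close>, where it is
  the derivative of \<open>\<bar>x\<bar> powr q\<close> up to the factor \<open>q\<close>. For equal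
  signs subadditivity suffices; for opposite signs both absolute values are at most
  \<open>\<bar>u - v\<bar>\<close>, which costs the factor 2.\<close>

lemma signed_powr_diff_le:
  fixes u v s :: real
  assumes "0 < s" "s \<le> 1"
  shows "\<bar>sgn u * \<bar>u\<bar> powr s - sgn v * \<bar>v\<bar> powr s\<bar> \<le> 2 * \<bar>u - v\<bar> powr s"
proof -
  have *: "\<bar>sgn u * \<bar>u\<bar> powr s - sgn v * \<bar>v\<bar> powr s\<bar> \<le> 2 * \<bar>u - v\<bar> powr s" if "\<bar>v\<bar> \<le> \<bar>u\<bar>" for u v :: real
  proof (cases "u * v \<ge> 0")
    case True
    have eq: "\<bar>u\<bar> = \<bar>v\<bar> + \<bar>u - v\<bar>"
      using True that unfolding zero_le_mult_iff by linarith
    have "\<bar>u\<bar> powr s \<le> \<bar>v\<bar> powr s + \<bar>u - v\<bar> powr s"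
      by (subst eq, rule powr_add_subadditive) (use assms in auto)
    moreover have "\<bar>v\<bar> powr s \<le> \<bar>u\<bar> powr s"
      using that assms by (intro powr_mono2) auto
    moreover have "\<bar>sgn u * \<bar>u\<bar> powr s - sgn v * \<bar>v\<bar> powr s\<bar> = \<bar>u\<bar> powr s - \<bar>v\<bar> powr s"
      using True that calculation(2) by (auto simp: sgn_if zero_le_mult_iff)
    moreover have "0 \<le> \<bar>u - v\<bar> powr s" by simp
    ultimately show ?thesis by linarith
  next
    case False
    have "\<bar>u\<bar> powr s \<le> \<bar>u - v\<bar> powr s" "\<bar>v\<bar> powr s \<le> \<bar>u - v\<bar> powr s"
      using False assms by (auto intro!: powr_mono2 simp: zero_le_mult_iff)
    moreover have "\<bar>sgn u * \<bar>u\<bar> powr s - sgn v * \<bar>v\<bar> powr s\<bar> \<le> \<bar>u\<bar> powr s + \<bar>v\<bar> powr s"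
      by (intro order.trans[OF abs_triangle_ineq4] add_mono) (auto simp: abs_mult sgn_if)
    ultimately show ?thesis by linarith
  qed
  show ?thesis
    using *[of v u] *[of u v] by (metis abs_minus_commute linear)
qed

lemma mult_powr_le_powr_add:
  fixes x z q :: real
  assumes "1 < q"
  shows "\<bar>x\<bar> * \<bar>z\<bar> powr (q - 1) \<le> \<bar>x\<bar> powr q / q + (q - 1) / q * \<bar>z\<bar> powr q"
proof -
  have "\<bar>x\<bar> * \<bar>z\<bar> powr (q - 1) \<le> \<bar>x\<bar> powr q / q + (\<bar>z\<bar> powr (q - 1)) powr (q / (q - 1)) / (q / (q - 1))"
    using assms by (intro Youngs_inequality) (auto simp: field_simps)
  also have "(\<bar>z\<bar> powr (q - 1)) powr (q / (q - 1)) = \<bar>z\<bar> powr q"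
    using assms by (simp add: powr_powr)
  finally show ?thesis using assms by (simp add: field_simps)
qed

text \<open>Convexity of \<open>\<bar>x\<bar> powr q\<close>, as the tangent at \<open>z\<close>.
  Deriving it from Young's inequality needs no differentiation at the origin.\<close>

lemma abs_powr_tangent:
  fixes x z q :: real
  assumes "1 < q"
  shows "\<bar>z\<bar> powr q + q * (sgn z * \<bar>z\<bar> powr (q - 1)) * (x - z) \<le> \<bar>x\<bar> powr q"
proof -
  have "x * (sgn z * \<bar>z\<bar> powr (q - 1)) \<le> \<bar>x\<bar> * \<bar>z\<bar> powr (q - 1)"
  proof -
    have "x * sgn z \<le> \<bar>x\<bar>" by (auto simp: sgn_if)
    from mult_right_mono[OF this, of "\<bar>z\<bar> powr (q - 1)"] show ?thesis by (simp add: mult_ac)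
  qed
  also have "\<dots> \<le> \<bar>x\<bar> powr q / q + (q - 1) / q * \<bar>z\<bar> powr q"
    by (rule mult_powr_le_powr_add) fact
  finally have 1: "q * (x * (sgn z * \<bar>z\<bar> powr (q - 1))) \<le> \<bar>x\<bar> powr q + (q - 1) * \<bar>z\<bar> powr q"
    using assms by (simp add: field_simps)
  have "z * (sgn z * \<bar>z\<bar> powr (q - 1)) = \<bar>z\<bar> * \<bar>z\<bar> powr (q - 1)"
    by (simp add: sgn_if abs_if)
  also have "\<dots> = \<bar>z\<bar> powr q"
    by (cases "z = 0") (simp_all add: powr_diff)
  finally have 2: "z * (sgn z * \<bar>z\<bar> powr (q - 1)) = \<bar>z\<bar> powr q" .
  have "q * (sgn z * \<bar>z\<bar> powr (q - 1)) * (x - z)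
      = q * (x * (sgn z * \<bar>z\<bar> powr (q - 1))) - q * (z * (sgn z * \<bar>z\<bar> powr (q - 1)))"
    by (simp add: algebra_simps)
  also have "\<dots> \<le> \<bar>x\<bar> powr q + (q - 1) * \<bar>z\<bar> powr q - q * \<bar>z\<bar> powr q"
    using 1 unfolding 2 by simp
  finally show ?thesis by (simp add: algebra_simps)
qed

text \<open>The tangent at \<open>x + y\<close>, evaluated at \<open>x\<close>, bounds the left side
  with the derivative taken at \<open>x + y\<close>. Moving the derivative back to \<open>x\<close>
  costs a Hoelder error of order \<open>q - 1\<close>, multiplied by \<open>\<bar>y\<bar>\<close>;
  this is where \<open>q \<le> 2\<close> enters.\<close>

lemma abs_powr_add_le:
  fixes x y q :: real
  assumes "1 < q" "q \<le> 2"
  shows "\<bar>x + y\<bar> powr q \<le> \<bar>x\<bar> powr q + q * (sgn x * \<bar>x\<bar> powr (q - 1)) * y + 2 * q * \<bar>y\<bar> powr q"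
proof -
  let ?g = "\<lambda>z::real. sgn z * \<bar>z\<bar> powr (q - 1)"
  have "\<bar>x + y\<bar> powr q \<le> \<bar>x\<bar> powr q + q * ?g (x + y) * y"
    using abs_powr_tangent[OF assms(1), of "x + y" x] by (simp add: algebra_simps)
  also have "q * ?g (x + y) * y = q * ?g x * y + q * ((?g (x + y) - ?g x) * y)"
    by (simp add: algebra_simps)
  also have "(?g (x + y) - ?g x) * y \<le> \<bar>?g (x + y) - ?g x\<bar> * \<bar>y\<bar>"
    by (metis abs_ge_self abs_mult)
  also have "\<dots> \<le> 2 * \<bar>(x + y) - x\<bar> powr (q - 1) * \<bar>y\<bar>"
    using assms by (intro mult_right_mono signed_powr_diff_le) auto
  also have "\<dots> = 2 * \<bar>y\<bar> powr q"
    by (cases "y = 0") (simp_all add: powr_diff)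
  finally show ?thesis using assms by (simp add: mult_left_mono)
qed

text \<open>Binary expansion of \<open>n\<close>: clearing its digits one at a time moves down by at most
  one dyadic block of each length.\<close>
lemma dyadic_chaining:
  fixes f :: "nat \<Rightarrow> real"
  assumes B: "\<And>s i. s \<le> r \<Longrightarrow> (i + 1) * 2 ^ s \<le> 2 ^ r \<Longrightarrow> \<bar>f ((i + 1) * 2 ^ s) - f (i * 2 ^ s)\<bar> \<le> B"
    and n: "n \<le> 2 ^ r"
  shows "\<bar>f n - f 0\<bar> \<le> real (r + 1) * B"
proof -
  have B0: "B \<ge> 0" using B[of 0 0] abs_ge_zero by (smt (verit) add_0 le0 mult_1 one_le_power one_le_numeral power_0)
  have "\<bar>f n - f (n div 2 ^ s * 2 ^ s)\<bar> \<le> real s * B" if "s \<le> r + 1" for s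
    using that
  proof (induction s)
    case (Suc s)
    define i where "i = n div 2 ^ Suc s"
    have div: "n div 2 ^ s = 2 * i + n div 2 ^ s mod 2"
      unfolding i_def power_Suc2 div_mult2_eq by simp
    have i2: "n div 2 ^ Suc s * 2 ^ Suc s = 2 * i * 2 ^ s" by (simp add: i_def)
    have "\<bar>f (n div 2 ^ s * 2 ^ s) - f (n div 2 ^ Suc s * 2 ^ Suc s)\<bar> \<le> B"
    proof (cases "n div 2 ^ s mod 2 = 0")
      case True
      then show ?thesis using div B0 unfolding i2 by simp
    next
      case False
      hence *: "n div 2 ^ s = 2 * i + 1" using div by simp
      have "(2 * i + 1) * 2 ^ s \<le> n" unfolding *[symmetric] by simp
      thus ?thesis unfolding i2 * using Suc.prems n by (intro B) auto
    qed
    with Suc show ?case by (simp add: algebra_simps)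
  qed simp
  \<comment> \<open>The case \<open>n = 2 ^ r\<close> has \<open>r + 1\<close> binary digits, so
    that many steps are allowed; after them the quotient is 0.\<close>
  from this[of "r + 1"] n show ?thesis
    by (simp add: less_le_trans[of _ "2^r" "2 * 2^r"] div_less order_le_less_trans)
qed

subsection \<open>A strong law from block moments\<close>

lemma summable_powr_mult_exp:
  fixes a e :: real
  assumes "e > 0"
  shows "summable (\<lambda>r::nat. (real r + 1) powr a * 2 powr (- e * real r))"
proof (rule summable_comparison_test_bigo)
  show "summable (\<lambda>r::nat. norm (real r powr (-2)))"
    using summable_real_powr_iff[of "-2"] by simp
  show "(\<lambda>r::nat. (real r + 1) powr a * 2 powr (- e * real r)) \<in> O(\<lambda>r. real r powr (-2))"
    using assms by real_asymp
qed

text \<open>Borel--Cantelli in the form of Tonelli's theorem: the sum has a finite integral and is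
  therefore finite almost everywhere.\<close>

lemma AE_summable_of_nn_integral:
  fixes V :: "nat \<Rightarrow> 'a \<Rightarrow> real"
  assumes [measurable]: "\<And>r. V r \<in> borel_measurable M"
    and nonneg: "\<And>r \<omega>. 0 \<le> V r \<omega>"
    and bound: "\<And>r. (\<integral>\<^sup>+\<omega>. ennreal (V r \<omega>) \<partial>M) \<le> ennreal (w r)"
    and w: "\<And>r. 0 \<le> w r" "summable w"
  shows "AE \<omega> in M. summable (\<lambda>r. V r \<omega>)"
proof -
  have "(\<integral>\<^sup>+\<omega>. (\<Sum>r. ennreal (V r \<omega>)) \<partial>M) = (\<Sum>r. \<integral>\<^sup>+\<omega>. ennreal (V r \<omega>) \<partial>M)"
    by (rule nn_integral_suminf) simp
  also have "\<dots> \<le> (\<Sum>r. ennreal (w r))"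
    by (rule suminf_le) (auto simp: bound)
  also have "\<dots> = ennreal (suminf w)"
    using w by (rule suminf_ennreal2)
  finally have "(\<integral>\<^sup>+\<omega>. (\<Sum>r. ennreal (V r \<omega>)) \<partial>M) \<noteq> \<infinity>"
    by (metis ennreal_less_top infinity_ennreal_def linorder_not_less order_refl order_trans)
  hence "AE \<omega> in M. (\<Sum>r. ennreal (V r \<omega>)) \<noteq> \<infinity>"
    by (intro nn_integral_PInf_AE) auto
  thus ?thesis
    by eventually_elim (auto intro: summable_suminf_not_top nonneg)
qed

text \<open>The maximum over \<open>n \<le> 2 ^ r\<close> is controlled by dyadic blocks; a power of \<open>r\<close> is lost,
  which the strict inequality \<open>\<gamma> / q < 1 / p\<close> absorbs.\<close>
lemma strong_law_of_block_moments:
  fixes X :: "nat \<Rightarrow> 'a \<Rightarrow> real"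
  assumes [measurable]: "\<And>k. X k \<in> borel_measurable M"
    and q: "0 < q" and \<gamma>: "1 \<le> \<gamma>" and p: "0 < p" "\<gamma> / q < 1 / p" and C: "0 \<le> C"
    and bound: "\<And>m n. (\<integral>\<^sup>+\<omega>. ennreal (\<bar>\<Sum>k\<in>{m..<m+n}. X k \<omega>\<bar> powr q) \<partial>M) \<le> ennreal (C * real n powr \<gamma>)"
  shows "AE \<omega> in M. (\<lambda>n. (\<Sum>k<n. X k \<omega>) / real n powr (1 / p)) \<longlonglongrightarrow> 0"
proof -
  define S where "S n \<omega> = (\<Sum>k<n. X k \<omega>)" for n \<omega>
  \<comment> \<open>Adding up all dyadic blocks inside \<open>{0..2 ^ r}\<close> is a crude
    substitute for a maximum: each single increment is at most
    \<open>Q r \<omega> powr (1 / q)\<close>, and moments of a sum are easy.\<close>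
  define Q where "Q r \<omega> = (\<Sum>s\<le>r. \<Sum>i<2^(r-s). \<bar>S ((i+1) * 2^s) \<omega> - S (i * 2^s) \<omega>\<bar> powr q)" for r \<omega>
  \<comment> \<open>The factor \<open>(real r + 1) powr q\<close> comes from chaining, the power of
    2 from the normalisation at \<open>n = 2 ^ r\<close>.\<close>
  define V where "V r \<omega> = (real r + 1) powr q * 2 powr (- (q / p) * real r) * Q r \<omega>" for r \<omega>
  \<comment> \<open>The exponent \<open>q + 1\<close> collects \<open>q\<close> from chaining and 1
    from the \<open>r + 1\<close> scales in \<open>Q r\<close>; \<open>q / p - \<gamma>\<close> is
    positive by hypothesis.\<close>
  define w where "w r = C * ((real r + 1) powr (q + 1) * 2 powr (- (q / p - \<gamma>) * real r))" for r :: nat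
  have [measurable]: "S n \<in> borel_measurable M" for n unfolding S_def by measurable
  have [measurable]: "Q n \<in> borel_measurable M" for n unfolding Q_def by measurable
  have Q0: "0 \<le> Q r \<omega>" for r \<omega> unfolding Q_def by (intro sum_nonneg) auto
  have block: "S ((i+1) * 2^s) \<omega> - S (i * 2^s) \<omega> = (\<Sum>k\<in>{i*2^s..<i*2^s+2^s}. X k \<omega>)" for i s \<omega>
    unfolding S_def lessThan_atLeast0
    by (subst sum_diff_nat_ivl) (auto simp: algebra_simps)
  have max_bound: "\<bar>S n \<omega>\<bar> powr q \<le> (real r + 1) powr q * Q r \<omega>" if "n \<le> 2 ^ r" for n r \<omega>
  proof -
    have "\<bar>S n \<omega> - S 0 \<omega>\<bar> \<le> real (r + 1) * Q r \<omega> powr (1 / q)"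
    proof (rule dyadic_chaining[OF _ that, where f = "\<lambda>n. S n \<omega>"])
      fix s i assume s: "s \<le> r" and i: "(i + 1) * 2 ^ s \<le> (2 ^ r :: nat)"
      have "(2::nat) ^ r = 2 ^ (r - s) * 2 ^ s"
        using s by (simp flip: power_add)
      hence "(i + 1) * 2 ^ s \<le> 2 ^ (r - s) * 2 ^ s" using i by simp
      hence i': "i < 2 ^ (r - s)" by (subst (asm) mult_le_cancel2) simp
      have "\<bar>S ((i+1) * 2^s) \<omega> - S (i * 2^s) \<omega>\<bar> powr q
          \<le> (\<Sum>i<2^(r-s). \<bar>S ((i+1) * 2^s) \<omega> - S (i * 2^s) \<omega>\<bar> powr q)"
        using i' by (intro member_le_sum) auto
      also have "\<dots> \<le> Q r \<omega>" unfolding Q_def using s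
        by (intro member_le_sum[where f = "\<lambda>s. \<Sum>i<2^(r-s). \<bar>S ((i+1) * 2^s) \<omega> - S (i * 2^s) \<omega>\<bar> powr q"])
          (auto intro: sum_nonneg)
      finally have "(\<bar>S ((i+1) * 2^s) \<omega> - S (i * 2^s) \<omega>\<bar> powr q) powr (1 / q) \<le> Q r \<omega> powr (1 / q)"
        using q by (intro powr_mono2) auto
      thus "\<bar>S ((i+1) * 2^s) \<omega> - S (i * 2^s) \<omega>\<bar> \<le> Q r \<omega> powr (1 / q)"
        using q by (simp add: powr_powr)
    qed
    hence "\<bar>S n \<omega>\<bar> powr q \<le> (real (r + 1) * Q r \<omega> powr (1 / q)) powr q"
      using q by (intro powr_mono2) (auto simp: S_def)
    also have "\<dots> = (real r + 1) powr q * Q r \<omega>"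
      using q Q0[of r \<omega>] by (simp add: powr_mult powr_powr add.commute)
    finally show ?thesis .
  qed
  have Q_int: "(\<integral>\<^sup>+\<omega>. ennreal (Q r \<omega>) \<partial>M) \<le> ennreal (C * (real r + 1) * 2 powr (\<gamma> * real r))" for r
  proof -
    have "(\<integral>\<^sup>+\<omega>. ennreal (Q r \<omega>) \<partial>M) =
       (\<Sum>s\<le>r. \<Sum>i<2^(r-s). \<integral>\<^sup>+\<omega>. ennreal (\<bar>S ((i+1) * 2^s) \<omega> - S (i * 2^s) \<omega>\<bar> powr q) \<partial>M)"
      unfolding Q_def by (simp add: sum_nonneg nn_integral_sum flip: sum_ennreal)
    also have "\<dots> \<le> (\<Sum>s\<le>r. \<Sum>i<(2::nat)^(r-s). ennreal (C * real (2^s) powr \<gamma>))"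
      unfolding block by (intro sum_mono bound)
    also have "\<dots> = ennreal (\<Sum>s\<le>r. \<Sum>i<(2::nat)^(r-s). C * real (2^s) powr \<gamma>)"
      using C by (subst sum_ennreal[symmetric], simp add: sum_nonneg del: sum_constant)
        (intro sum.cong refl, subst sum_ennreal, simp_all del: sum_constant)
    also have "\<dots> \<le> ennreal (\<Sum>s\<le>r. C * 2 powr (\<gamma> * real r))"
    proof (intro ennreal_leI sum_mono)
      fix s assume "s \<in> {..r}"
      hence s: "s \<le> r" by simp
      have "(\<Sum>i<(2::nat)^(r-s). C * real (2^s) powr \<gamma>) = C * (2 powr real (r - s) * 2 powr (real s * \<gamma>))"
        by (simp add: powr_realpow powr_powr flip: powr_realpow)
      \<comment> \<open>Here \<open>1 \<le> \<gamma>\<close> is used: the number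
        \<open>2 ^ (r - s)\<close> of blocks is at most its own power \<open>\<gamma>\<close>, so
        that every scale contributes no more than the coarsest one.\<close>
      also have "\<dots> \<le> C * (2 powr (\<gamma> * real (r - s)) * 2 powr (real s * \<gamma>))"
        using C \<gamma> by (intro mult_left_mono mult_right_mono powr_mono) (auto simp: mult_le_cancel_right1)
      also have "\<dots> = C * 2 powr (\<gamma> * real r)"
        using s by (simp add: algebra_simps of_nat_diff flip: powr_add)
      finally show "(\<Sum>i<(2::nat)^(r-s). C * real (2^s) powr \<gamma>) \<le> C * 2 powr (\<gamma> * real r)" .
    qed
    finally show ?thesis by (simp add: algebra_simps)
  qed
  have "AE \<omega> in M. summable (\<lambda>r. V r \<omega>)"
  proof (rule AE_summable_of_nn_integral[where w = w])
    show "V r \<in> borel_measurable M" for r unfolding V_def by measurable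
    show "0 \<le> V r \<omega>" for r \<omega> unfolding V_def using Q0 by simp
    show "0 \<le> w r" for r unfolding w_def using C by simp
    show "summable w"
      unfolding w_def using p q by (intro summable_mult summable_powr_mult_exp) (simp add: field_simps)
    show "(\<integral>\<^sup>+\<omega>. ennreal (V r \<omega>) \<partial>M) \<le> ennreal (w r)" for r
    proof -
      have "(\<integral>\<^sup>+\<omega>. ennreal (V r \<omega>) \<partial>M)
          = ennreal ((real r + 1) powr q * 2 powr (- (q / p) * real r)) * (\<integral>\<^sup>+\<omega>. ennreal (Q r \<omega>) \<partial>M)"
        unfolding V_def using Q0 by (subst ennreal_mult) (auto simp: nn_integral_cmult)
      also have "\<dots> \<le> ennreal ((real r + 1) powr q * 2 powr (- (q / p) * real r))
            * ennreal (C * (real r + 1) * 2 powr (\<gamma> * real r))"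
        by (intro mult_left_mono Q_int) auto
      also have "\<dots> = ennreal (w r)"
      proof -
        have 1: "2 powr (- (q / p) * real r) * 2 powr (\<gamma> * real r) = 2 powr (- (q / p - \<gamma>) * real r)"
          by (simp add: algebra_simps flip: powr_add)
        have 2: "(real r + 1) powr q * (real r + 1) = (real r + 1) powr (q + 1)"
          by (simp add: powr_add)
        have "a * b * (C * c * d) = C * ((a * c) * (b * d))" for a b c d :: real
          by (simp add: mult_ac)
        hence "((real r + 1) powr q * 2 powr (- (q / p) * real r)) * (C * (real r + 1) * 2 powr (\<gamma> * real r)) = w r"
          unfolding w_def 1[symmetric] 2[symmetric] .
        thus ?thesis using C by (simp flip: ennreal_mult)
      qed
      finally show ?thesis .
    qed
  qed
  thus ?thesis
  proof eventually_elim
    case (elim \<omega>)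
    have V0: "(\<lambda>r. V r \<omega>) \<longlonglongrightarrow> 0" using elim by (rule summable_LIMSEQ_zero)
    show ?case
    proof (rule LIMSEQ_I)
      fix e :: real assume e: "0 < e"
      \<comment> \<open>An \<open>n\<close> between \<open>2 ^ r\<close> and
        \<open>2 ^ (r + 1)\<close> is handled at level \<open>r + 1\<close>; the factor
        \<open>2 powr (q / p)\<close> pays for this change of level, the other 2 makes the final
        inequality strict.\<close>
      define \<delta> where "\<delta> = e powr q / (2 * 2 powr (q / p))"
      have \<delta>: "\<delta> > 0" using e by (simp add: \<delta>_def)
      obtain R where R: "\<And>r. r \<ge> R \<Longrightarrow> V r \<omega> < \<delta>"
        using LIMSEQ_D[OF V0 \<delta>] by (metis abs_ge_self diff_zero order_le_less_trans real_norm_def)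
      show "\<exists>n0. \<forall>n\<ge>n0. norm ((\<Sum>k<n. X k \<omega>) / real n powr (1 / p) - 0) < e"
      proof (intro exI[of _ "2 ^ R"] allI impI)
        fix n :: nat assume n: "n \<ge> 2 ^ R"
        hence n1: "n \<ge> 1" by (metis one_le_numeral one_le_power order_trans)
        then obtain r where r: "2 ^ r \<le> n" "n < 2 ^ (r + 1)"
          using ex_power_ivl1[of 2 n] by auto
        have "R \<le> r" using n r(2) by (metis Suc_eq_plus1 less_Suc_eq_le nat_power_less_imp_less order_le_less_trans zero_less_numeral)
        hence VR: "V (r + 1) \<omega> < \<delta>" by (intro R) simp
        have "(real (r + 1) + 1) powr q * Q (r + 1) \<omega> = V (r + 1) \<omega> * 2 powr (q / p * real (r + 1))"
          unfolding V_def by (simp add: powr_minus field_simps)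
        also have "\<dots> \<le> \<delta> * 2 powr (q / p * real (r + 1))"
          using VR by (intro mult_right_mono) auto
        also have "\<dots> = e powr q / 2 * (2 powr real r) powr (q / p)"
          by (simp add: \<delta>_def powr_powr distrib_left powr_add mult.commute)
        also have "\<dots> \<le> e powr q / 2 * real n powr (q / p)"
        proof (intro mult_left_mono powr_mono2)
          show "2 powr real r \<le> real n" using r(1) by (simp add: powr_realpow)
        qed (use p q in auto)
        also have "\<dots> < e powr q * real n powr (q / p)"
          using e n1 by simp
        also have "\<dots> = (e * real n powr (1 / p)) powr q"
          using e by (simp add: powr_mult powr_powr)
        finally have "\<bar>S n \<omega>\<bar> powr q < (e * real n powr (1 / p)) powr q"
          using max_bound[of n "r + 1" \<omega>] r(2) by simp
        hence "\<bar>S n \<omega>\<bar> < e * real n powr (1 / p)"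
          using q e by (meson abs_ge_zero linorder_not_le powr_mono2 less_imp_le mult_nonneg_nonneg powr_ge_zero)
        thus "norm ((\<Sum>k<n. X k \<omega>) / real n powr (1 / p) - 0) < e"
          using n1 by (simp add: S_def abs_mult divide_less_eq)
      qed
    qed
  qed
qed

text \<open>Fatou's lemma, used to carry moment bounds that are uniform in the truncation over to
  the limit.\<close>

lemma nn_integral_powr_limit_le:
  fixes F :: "nat \<Rightarrow> 'a \<Rightarrow> real"
  assumes [measurable]: "\<And>N. F N \<in> borel_measurable M" "f \<in> borel_measurable M" and q: "0 < q"
    and lim: "AE \<omega> in M. (\<lambda>N. F N \<omega>) \<longlonglongrightarrow> f \<omega>"
    and bound: "\<And>N. (\<integral>\<^sup>+\<omega>. ennreal (\<bar>F N \<omega>\<bar> powr q) \<partial>M) \<le> B"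
  shows "(\<integral>\<^sup>+\<omega>. ennreal (\<bar>f \<omega>\<bar> powr q) \<partial>M) \<le> B"
proof -
  have "AE \<omega> in M. liminf (\<lambda>N. ennreal (\<bar>F N \<omega>\<bar> powr q)) = ennreal (\<bar>f \<omega>\<bar> powr q)"
    using lim
  proof eventually_elim
    case (elim \<omega>)
    have "(\<lambda>N. ennreal (\<bar>F N \<omega>\<bar> powr q)) \<longlonglongrightarrow> ennreal (\<bar>f \<omega>\<bar> powr q)"
      using elim q by (intro tendsto_ennrealI tendsto_powr2 tendsto_rabs) auto
    thus ?case by (intro lim_imp_Liminf) auto
  qed
  hence "(\<integral>\<^sup>+\<omega>. ennreal (\<bar>f \<omega>\<bar> powr q) \<partial>M) = (\<integral>\<^sup>+\<omega>. liminf (\<lambda>N. ennreal (\<bar>F N \<omega>\<bar> powr q)) \<partial>M)"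
    by (intro nn_integral_cong_AE) auto
  also have "\<dots> \<le> liminf (\<lambda>N. \<integral>\<^sup>+\<omega>. ennreal (\<bar>F N \<omega>\<bar> powr q) \<partial>M)"
    by (rule nn_integral_liminf) measurable
  also have "\<dots> \<le> limsup (\<lambda>N. \<integral>\<^sup>+\<omega>. ennreal (\<bar>F N \<omega>\<bar> powr q) \<partial>M)"
    by (rule Liminf_le_Limsup) simp
  also have "\<dots> \<le> B"
    by (rule Limsup_bounded) (simp add: bound)
  finally show ?thesis .
qed

lemma strong_law_of_limit_window_moments:
  fixes F :: "nat \<Rightarrow> int \<Rightarrow> 'a \<Rightarrow> real"
  assumes [measurable]: "\<And>N k. F N k \<in> borel_measurable M"
    and conv: "AE \<omega> in M. \<forall>k. convergent (\<lambda>N. F N k \<omega>)"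
    and q: "0 < q" and \<gamma>: "1 \<le> \<gamma>" and p: "0 < p" "\<gamma> / q < 1 / p" and C: "0 \<le> C"
    and bound: "\<And>N b n. (\<integral>\<^sup>+\<omega>. ennreal (\<bar>\<Sum>k\<in>{b<..b + int n}. F N k \<omega>\<bar> powr q) \<partial>M) \<le> ennreal (C * real n powr \<gamma>)"
  shows "AE \<omega> in M. (\<lambda>n. (\<Sum>k\<in>{1..int n}. lim (\<lambda>N. F N k \<omega>)) / real n powr (1 / p)) \<longlonglongrightarrow> 0"
proof -
  define X where "X k \<omega> = lim (\<lambda>N. F N k \<omega>)" for k \<omega>
  have [measurable]: "X k \<in> borel_measurable M" for k unfolding X_def by measurable
  \<comment> \<open>Position \<open>k\<close> of the one-sided sequence carries the integer index
    \<open>k + 1\<close>; hence windows are open on the left and the full sum runs over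
    \<open>{1..int n}\<close>.\<close>
  have reindex: "(\<Sum>k\<in>{m..<m+n}. X (int k + 1) \<omega>) = (\<Sum>k\<in>{int m<..int m + int n}. X k \<omega>)" for m n \<omega>
    by (rule sum.reindex_bij_witness[of _ "\<lambda>k. nat (k - 1)" "\<lambda>k. int k + 1"]) auto
  have "AE \<omega> in M. (\<lambda>n. (\<Sum>k<n. X (int k + 1) \<omega>) / real n powr (1 / p)) \<longlonglongrightarrow> 0"
  proof (rule strong_law_of_block_moments[OF _ q \<gamma> p C])
    fix m n
    show "(\<integral>\<^sup>+\<omega>. ennreal (\<bar>\<Sum>k\<in>{m..<m+n}. X (int k + 1) \<omega>\<bar> powr q) \<partial>M) \<le> ennreal (C * real n powr \<gamma>)"
      unfolding reindex
    proof (rule nn_integral_powr_limit_le[OF _ _ q _ bound])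
      show "AE \<omega> in M. (\<lambda>N. \<Sum>k\<in>{int m<..int m + int n}. F N k \<omega>) \<longlonglongrightarrow> (\<Sum>k\<in>{int m<..int m + int n}. X k \<omega>)"
        using conv by eventually_elim (auto intro!: tendsto_sum simp: X_def convergent_LIMSEQ_iff)
    qed measurable
  qed measurable
  moreover have "(\<Sum>k<n. X (int k + 1) \<omega>) = (\<Sum>k\<in>{1..int n}. X k \<omega>)" for n \<omega>
    by (rule sum.reindex_bij_witness[of _ "\<lambda>k. nat (k - 1)" "\<lambda>k. int k + 1"]) auto
  ultimately show ?thesis by (simp add: X_def)
qed

subsection \<open>Moment inequalities under independence\<close>

context prob_space
begin

lemma integrable_powr_add:
  fixes S Y :: "'a \<Rightarrow> real"
  assumes [measurable]: "random_variable borel S" "random_variable borel Y" and q: "0 < q"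
    and int: "integrable M (\<lambda>\<omega>. \<bar>S \<omega>\<bar> powr q)" "integrable M (\<lambda>\<omega>. \<bar>Y \<omega>\<bar> powr q)"
  shows "integrable M (\<lambda>\<omega>. \<bar>S \<omega> + Y \<omega>\<bar> powr q)"
proof (rule Bochner_Integration.integrable_bound)
  show "integrable M (\<lambda>\<omega>. 2 powr q * (\<bar>S \<omega>\<bar> powr q + \<bar>Y \<omega>\<bar> powr q))"
    using int by (intro integrable_mult_right Bochner_Integration.integrable_add)
  show "AE \<omega> in M. norm (\<bar>S \<omega> + Y \<omega>\<bar> powr q) \<le> norm (2 powr q * (\<bar>S \<omega>\<bar> powr q + \<bar>Y \<omega>\<bar> powr q))"
  proof (rule AE_I2)
    fix \<omega>
    have "\<bar>S \<omega> + Y \<omega>\<bar> powr q \<le> (2 * max \<bar>S \<omega>\<bar> \<bar>Y \<omega>\<bar>) powr q"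
      using q by (intro powr_mono2) auto
    also have "\<dots> = 2 powr q * max \<bar>S \<omega>\<bar> \<bar>Y \<omega>\<bar> powr q" by (simp add: powr_mult)
    also have "\<dots> \<le> 2 powr q * (\<bar>S \<omega>\<bar> powr q + \<bar>Y \<omega>\<bar> powr q)"
      by (intro mult_left_mono) (auto simp: max_def)
    finally show "norm (\<bar>S \<omega> + Y \<omega>\<bar> powr q) \<le> norm (2 powr q * (\<bar>S \<omega>\<bar> powr q + \<bar>Y \<omega>\<bar> powr q))"
      by simp
  qed
qed measurable

lemma integrable_of_integrable_powr:
  fixes S :: "'a \<Rightarrow> real"
  assumes [measurable]: "random_variable borel S" and q: "1 \<le> q"
    and int: "integrable M (\<lambda>\<omega>. \<bar>S \<omega>\<bar> powr q)"
  shows "integrable M S"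
proof (rule Bochner_Integration.integrable_bound)
  show "integrable M (\<lambda>\<omega>. 1 + \<bar>S \<omega>\<bar> powr q)" using int by simp
  have "\<bar>S \<omega>\<bar> \<le> 1 + \<bar>S \<omega>\<bar> powr q" for \<omega>
  proof (cases "\<bar>S \<omega>\<bar> \<le> 1")
    case False
    hence "\<bar>S \<omega>\<bar> powr 1 \<le> \<bar>S \<omega>\<bar> powr q" using q by (intro powr_mono) auto
    with False show ?thesis by simp
  qed (simp add: add_increasing2)
  thus "AE \<omega> in M. norm (S \<omega>) \<le> norm (1 + \<bar>S \<omega>\<bar> powr q)" by simp
qed measurable

text \<open>The zero in \<open>(x \<omega>, 0)\<close> is a dummy: \<open>indep_var\<close> requires both variables to have the same type.\<close>
lemma moment_add_mult_indep:
  fixes S Y x :: "'a \<Rightarrow> real"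
  assumes q: "1 < q" "q \<le> 2"
    and ind: "indep_var borel (\<lambda>\<omega>. (S \<omega>, Y \<omega>)) borel (\<lambda>\<omega>. (x \<omega>, 0))"
    and int: "integrable M (\<lambda>\<omega>. \<bar>S \<omega>\<bar> powr q)" "integrable M (\<lambda>\<omega>. \<bar>Y \<omega>\<bar> powr q)"
      "integrable M (\<lambda>\<omega>. \<bar>x \<omega>\<bar> powr q)"
    and mean: "expectation x = 0"
  shows "integrable M (\<lambda>\<omega>. \<bar>S \<omega> + x \<omega> * Y \<omega>\<bar> powr q)" (is ?int)
    and "expectation (\<lambda>\<omega>. \<bar>S \<omega> + x \<omega> * Y \<omega>\<bar> powr q)
      \<le> expectation (\<lambda>\<omega>. \<bar>S \<omega>\<bar> powr q)
        + 2 * q * (expectation (\<lambda>\<omega>. \<bar>x \<omega>\<bar> powr q) * expectation (\<lambda>\<omega>. \<bar>Y \<omega>\<bar> powr q))" (is ?le)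
proof -
  have SY: "random_variable borel (\<lambda>\<omega>. (S \<omega>, Y \<omega>))"
    and x0: "random_variable borel (\<lambda>\<omega>. (x \<omega>, 0 :: real))"
    using ind by (auto dest: indep_var_rv1 indep_var_rv2)
  have [measurable]: "random_variable borel x"
    using measurable_compose[OF x0, of fst borel] by (simp add: borel_prod[symmetric])
  have [measurable]: "random_variable borel S" "random_variable borel Y"
    using measurable_compose[OF SY, of fst borel] measurable_compose[OF SY, of snd borel]
    by (simp_all add: borel_prod[symmetric])
  have ind': "indep_var borel (\<lambda>\<omega>. f (S \<omega>, Y \<omega>)) borel (\<lambda>\<omega>. g (x \<omega>))"
    if "f \<in> borel_measurable borel" "g \<in> borel_measurable borel" for f :: "real \<times> real \<Rightarrow> real" and g :: "real \<Rightarrow> real"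
  proof -
    have "(\<lambda>z. g (fst z)) \<in> borel_measurable (borel :: (real \<times> real) measure)"
      using that(2) unfolding borel_prod[symmetric] by measurable
    from indep_var_compose[OF ind that(1) this] show ?thesis by (simp add: comp_def)
  qed
  \<comment> \<open>Up to the factor \<open>q\<close> this is the derivative of
    \<open>\<bar>z\<bar> powr q\<close>; \<open>g (S \<omega>) * Y \<omega>\<close> is integrable by
    Young's inequality with exponents \<open>q\<close> and \<open>q / (q - 1)\<close>.\<close>
  define g where "g = (\<lambda>z::real. sgn z * \<bar>z\<bar> powr (q - 1))"
  have [measurable]: "g \<in> borel_measurable borel" unfolding g_def by measurable
  have int_x: "integrable M x"
    using int(3) q by (intro integrable_of_integrable_powr[of x q]) auto
  have int_gY: "integrable M (\<lambda>\<omega>. g (S \<omega>) * Y \<omega>)"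
  proof (rule Bochner_Integration.integrable_bound)
    show "integrable M (\<lambda>\<omega>. \<bar>Y \<omega>\<bar> powr q / q + (q - 1) / q * \<bar>S \<omega>\<bar> powr q)"
      using int by (intro Bochner_Integration.integrable_add integrable_mult_right integrable_divide)
    have "norm (g (S \<omega>) * Y \<omega>) \<le> \<bar>Y \<omega>\<bar> powr q / q + (q - 1) / q * \<bar>S \<omega>\<bar> powr q" for \<omega>
    proof -
      have "norm (g (S \<omega>) * Y \<omega>) \<le> \<bar>Y \<omega>\<bar> * \<bar>S \<omega>\<bar> powr (q - 1)"
        by (simp add: g_def abs_mult sgn_if)
      also have "\<dots> \<le> \<bar>Y \<omega>\<bar> powr q / q + (q - 1) / q * \<bar>S \<omega>\<bar> powr q"
        by (rule mult_powr_le_powr_add) (rule q)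
      finally show ?thesis .
    qed
    thus "AE \<omega> in M. norm (g (S \<omega>) * Y \<omega>) \<le> norm (\<bar>Y \<omega>\<bar> powr q / q + (q - 1) / q * \<bar>S \<omega>\<bar> powr q)"
      using q by (intro AE_I2) (simp add: abs_of_nonneg)
  qed measurable
  have "(\<lambda>z. g (fst z) * snd z) \<in> borel_measurable borel"
    unfolding borel_prod[symmetric] by measurable
  from ind'[OF this, of "\<lambda>x. x"] have i1: "indep_var borel (\<lambda>\<omega>. g (S \<omega>) * Y \<omega>) borel x" by simp
  \<comment> \<open>The linear term vanishes in mean because the centred \<open>x\<close> is
    independent of the pair \<open>(S, Y)\<close>. No independence between \<open>S\<close> and
    \<open>Y\<close> is involved.\<close>
  have cross: "integrable M (\<lambda>\<omega>. g (S \<omega>) * Y \<omega> * x \<omega>)" "expectation (\<lambda>\<omega>. g (S \<omega>) * Y \<omega> * x \<omega>) = 0"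
    using indep_var_integrable[OF i1 int_gY int_x] indep_var_lebesgue_integral[OF i1 int_gY int_x] mean
    by simp_all
  have "(\<lambda>z. \<bar>snd z\<bar> powr q) \<in> borel_measurable (borel :: (real \<times> real) measure)"
    unfolding borel_prod[symmetric] by measurable
  from ind'[OF this, of "\<lambda>x. \<bar>x\<bar> powr q"]
  have i2: "indep_var borel (\<lambda>\<omega>. \<bar>Y \<omega>\<bar> powr q) borel (\<lambda>\<omega>. \<bar>x \<omega>\<bar> powr q)" by simp
  have xY: "integrable M (\<lambda>\<omega>. \<bar>x \<omega> * Y \<omega>\<bar> powr q)"
    "expectation (\<lambda>\<omega>. \<bar>x \<omega> * Y \<omega>\<bar> powr q) = expectation (\<lambda>\<omega>. \<bar>x \<omega>\<bar> powr q) * expectation (\<lambda>\<omega>. \<bar>Y \<omega>\<bar> powr q)"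
    using indep_var_integrable[OF i2 int(2,3)] indep_var_lebesgue_integral[OF i2 int(2,3)]
    by (simp_all add: abs_mult powr_mult mult.commute)
  show int': ?int
    by (rule integrable_powr_add) (use int(1) xY q in auto)
  have "expectation (\<lambda>\<omega>. \<bar>S \<omega> + x \<omega> * Y \<omega>\<bar> powr q)
      \<le> expectation (\<lambda>\<omega>. \<bar>S \<omega>\<bar> powr q + q * (g (S \<omega>) * Y \<omega> * x \<omega>) + 2 * q * \<bar>x \<omega> * Y \<omega>\<bar> powr q)"
  proof (rule integral_mono)
    show "\<bar>S \<omega> + x \<omega> * Y \<omega>\<bar> powr q \<le> \<bar>S \<omega>\<bar> powr q + q * (g (S \<omega>) * Y \<omega> * x \<omega>) + 2 * q * \<bar>x \<omega> * Y \<omega>\<bar> powr q" for \<omega>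
      using abs_powr_add_le[OF q, of "S \<omega>" "x \<omega> * Y \<omega>"] by (simp add: g_def mult_ac)
  qed (use int' int(1) xY(1) cross(1) in auto)
  also have "\<dots> = expectation (\<lambda>\<omega>. \<bar>S \<omega>\<bar> powr q)
        + 2 * q * (expectation (\<lambda>\<omega>. \<bar>x \<omega>\<bar> powr q) * expectation (\<lambda>\<omega>. \<bar>Y \<omega>\<bar> powr q))"
    using int(1) xY cross by simp
  finally show ?le .
qed

text \<open>A von Bahr--Esseen inequality: the factor \<open>h i\<close> depends only on the past, so the linear term
  of \<open>abs_powr_add_le\<close> has mean zero at every step.\<close>
lemma moment_martingale_transform:
  fixes X :: "'i::linorder \<Rightarrow> 'a \<Rightarrow> 'b" and g :: "'b \<Rightarrow> real" and h :: "'i \<Rightarrow> ('i \<Rightarrow> 'b) \<Rightarrow> real"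
  assumes q: "1 < q" "q \<le> 2" and "finite I"
    and ind: "indep_vars (\<lambda>_. N) X UNIV"
    and g[measurable]: "g \<in> borel_measurable N"
    and gint: "\<And>i. i \<in> I \<Longrightarrow> integrable M (\<lambda>\<omega>. \<bar>g (X i \<omega>)\<bar> powr q)"
    and mean: "\<And>i. i \<in> I \<Longrightarrow> expectation (\<lambda>\<omega>. g (X i \<omega>)) = 0"
    and h: "\<And>i. i \<in> I \<Longrightarrow> h i \<in> borel_measurable (PiM {..<i} (\<lambda>_. N))"
    and hint: "\<And>i. i \<in> I \<Longrightarrow> integrable M (\<lambda>\<omega>. \<bar>h i (\<lambda>j\<in>{..<i}. X j \<omega>)\<bar> powr q)"
  shows "integrable M (\<lambda>\<omega>. \<bar>\<Sum>i\<in>I. g (X i \<omega>) * h i (\<lambda>j\<in>{..<i}. X j \<omega>)\<bar> powr q)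
    \<and> expectation (\<lambda>\<omega>. \<bar>\<Sum>i\<in>I. g (X i \<omega>) * h i (\<lambda>j\<in>{..<i}. X j \<omega>)\<bar> powr q)
      \<le> 2 * q * (\<Sum>i\<in>I. expectation (\<lambda>\<omega>. \<bar>g (X i \<omega>)\<bar> powr q)
          * expectation (\<lambda>\<omega>. \<bar>h i (\<lambda>j\<in>{..<i}. X j \<omega>)\<bar> powr q))"
  using \<open>finite I\<close> gint mean h hint
\<comment> \<open>Each step adds an index above all earlier ones, so the sum built so far and the
  factor of the new term both belong to its past.\<close>
proof (induction I rule: finite_linorder_max_induct)
  case empty
  then show ?case by simp
next
  case (insert m A)
  define S where "S \<omega> = (\<Sum>i\<in>A. g (X i \<omega>) * h i (\<lambda>j\<in>{..<i}. X j \<omega>))" for \<omega>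
  define Y where "Y \<omega> = h m (\<lambda>j\<in>{..<m}. X j \<omega>)" for \<omega>
  define x where "x \<omega> = g (X m \<omega>)" for \<omega>
  have IH: "integrable M (\<lambda>\<omega>. \<bar>S \<omega>\<bar> powr q)"
    "expectation (\<lambda>\<omega>. \<bar>S \<omega>\<bar> powr q) \<le> 2 * q * (\<Sum>i\<in>A. expectation (\<lambda>\<omega>. \<bar>g (X i \<omega>)\<bar> powr q)
          * expectation (\<lambda>\<omega>. \<bar>h i (\<lambda>j\<in>{..<i}. X j \<omega>)\<bar> powr q))"
    using insert.IH insert.prems unfolding S_def by blast+
  \<comment> \<open>Exhibits the pair \<open>(S, Y)\<close> as a measurable function of the
    variables with index below \<open>m\<close>, which independence separates from
    \<open>X m\<close>.\<close>
  define f where "f = (\<lambda>z. (\<Sum>i\<in>A. g (z i) * h i (restrict z {..<i}), h m z))"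
  have "f \<in> measurable (PiM {..<m} (\<lambda>_. N)) (borel \<Otimes>\<^sub>M borel)"
    unfolding f_def
  proof (intro measurable_Pair borel_measurable_sum borel_measurable_times)
    fix i assume i: "i \<in> A"
    hence im: "i < m" using insert.hyps by auto
    show "(\<lambda>z. g (z i)) \<in> borel_measurable (PiM {..<m} (\<lambda>_. N))"
      using im by (intro measurable_compose[OF _ g] measurable_component_singleton) auto
    show "(\<lambda>z. h i (restrict z {..<i})) \<in> borel_measurable (PiM {..<m} (\<lambda>_. N))"
      using im i by (intro measurable_compose[OF _ insert.prems(3)] measurable_restrict_subset) auto
  qed (use insert.prems(3) in auto)
  hence f: "f \<in> measurable (PiM {..<m} (\<lambda>_. N)) borel" unfolding borel_prod .
  have "(\<lambda>z. (g (z m), 0 :: real)) \<in> measurable (PiM {m} (\<lambda>_. N)) (borel \<Otimes>\<^sub>M borel)"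
    by (intro measurable_Pair measurable_compose[OF _ g] measurable_component_singleton) auto
  hence gm: "(\<lambda>z. (g (z m), 0 :: real)) \<in> measurable (PiM {m} (\<lambda>_. N)) borel" unfolding borel_prod .
  have "f (\<lambda>j\<in>{..<m}. X j \<omega>) = (S \<omega>, Y \<omega>)" for \<omega>
  proof -
    have "g ((\<lambda>j\<in>{..<m}. X j \<omega>) i) * h i (restrict (\<lambda>j\<in>{..<m}. X j \<omega>) {..<i})
        = g (X i \<omega>) * h i (\<lambda>j\<in>{..<i}. X j \<omega>)" if "i \<in> A" for i
    proof -
      have im: "i < m" using insert.hyps that by auto
      hence "restrict (\<lambda>j\<in>{..<m}. X j \<omega>) {..<i} = (\<lambda>j\<in>{..<i}. X j \<omega>)"
        by (auto simp: restrict_def fun_eq_iff)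
      with im show ?thesis by simp
    qed
    thus ?thesis by (simp add: f_def S_def Y_def)
  qed
  hence "indep_var borel (\<lambda>\<omega>. (S \<omega>, Y \<omega>)) borel (\<lambda>\<omega>. (x \<omega>, 0))"
    using indep_var_compose[OF indep_var_restrict[OF ind, of "{..<m}" "{m}"] f gm]
    by (simp add: comp_def x_def)
  note step = moment_add_mult_indep[OF q this IH(1)]
  have eq: "(\<Sum>i\<in>insert m A. g (X i \<omega>) * h i (\<lambda>j\<in>{..<i}. X j \<omega>)) = S \<omega> + x \<omega> * Y \<omega>" for \<omega>
    using insert.hyps by (subst sum.insert) (auto simp: S_def x_def Y_def)
  have "integrable M (\<lambda>\<omega>. \<bar>Y \<omega>\<bar> powr q)" "integrable M (\<lambda>\<omega>. \<bar>x \<omega>\<bar> powr q)" "expectation x = 0"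
    using insert.prems unfolding Y_def x_def[abs_def] by blast+
  note step = step[OF this]
  have "m \<notin> A" using insert.hyps by auto
  with step IH(2) q insert.hyps(1) show ?case
    unfolding eq by (simp add: distrib_left x_def[symmetric] Y_def[symmetric] del: restrict_apply)
qed

end

text \<open>On the shell where \<open>\<bar>Z\<bar>\<close> lies between \<open>2 ^ j\<close> and
  \<open>2 ^ (j + 1)\<close> the power is at most \<open>2 powr ((j + 1) * q)\<close>, while the
  tail has probability at most \<open>C * 2 powr (- j * \<alpha>)\<close>. The resulting geometric
  series has ratio \<open>2 powr (q - \<alpha>) < 1\<close>.\<close>

lemma (in prob_space) integrable_powr_of_tail:
  fixes Z :: "'a \<Rightarrow> real"
  assumes [measurable]: "random_variable borel Z" and q: "0 < q" "q < \<alpha>"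
    and tail: "\<And>t. 0 \<le> t \<Longrightarrow> t powr \<alpha> * prob {\<omega> \<in> space M. \<bar>Z \<omega>\<bar> > t} \<le> C"
  shows "integrable M (\<lambda>\<omega>. \<bar>Z \<omega>\<bar> powr q)"
proof -
  define B where "B j = {\<omega> \<in> space M. \<bar>Z \<omega>\<bar> > 2 ^ j}" for j :: nat
  have [measurable]: "B j \<in> sets M" for j unfolding B_def by measurable
  have C0: "0 \<le> C" using tail[of 1] by (smt (verit) measure_nonneg mult_nonneg_nonneg powr_ge_zero)
  define w where "w j = C * 2 powr q * (2 powr (q - \<alpha>)) ^ j" for j :: nat
  have w0: "0 \<le> w j" for j unfolding w_def using C0 by simp
  have "summable w"
    unfolding w_def using q by (intro summable_mult summable_geometric) (simp add: powr_less_one)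
  have w: "ennreal (2 powr ((real j + 1) * q)) * emeasure M (B j) \<le> ennreal (w j)" for j
  proof -
    have "2 powr (real j * \<alpha>) * prob (B j) \<le> C"
      using tail[of "2 ^ j"] unfolding B_def by (simp add: powr_powr flip: powr_realpow)
    hence "2 powr ((real j + 1) * q - real j * \<alpha>) * (2 powr (real j * \<alpha>) * prob (B j))
        \<le> 2 powr ((real j + 1) * q - real j * \<alpha>) * C"
      by (intro mult_left_mono) auto
    also have "\<dots> = w j"
      by (simp add: w_def algebra_simps powr_powr flip: powr_realpow powr_add)
    finally have "2 powr ((real j + 1) * q) * prob (B j) \<le> w j"
      by (simp add: powr_diff)
    thus ?thesis
      by (simp add: emeasure_eq_measure ennreal_leI flip: ennreal_mult)
  qed
  have pw: "ennreal (\<bar>Z \<omega>\<bar> powr q) \<le> 1 + (\<Sum>j. ennreal (2 powr ((real j + 1) * q)) * indicator (B j) \<omega>)"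
    if "\<omega> \<in> space M" for \<omega>
  proof (cases "\<bar>Z \<omega>\<bar> \<le> 1")
    case True
    hence "\<bar>Z \<omega>\<bar> powr q \<le> 1 powr q" using q by (intro powr_mono2) auto
    hence "ennreal (\<bar>Z \<omega>\<bar> powr q) \<le> 1" by (simp add: ennreal_le_1)
    thus ?thesis by (simp add: add_increasing2)
  next
    case False
    obtain n where "\<bar>Z \<omega>\<bar> < 2 ^ n"
      using real_arch_pow[of 2 "\<bar>Z \<omega>\<bar>"] by auto
    hence n: "\<bar>Z \<omega>\<bar> \<le> 2 ^ n" by simp
    \<comment> \<open>The least such exponent locates the shell containing
      \<open>Z \<omega>\<close>.\<close>
    define n0 where "n0 = (LEAST n. \<bar>Z \<omega>\<bar> \<le> 2 ^ n)"
    have n0: "\<bar>Z \<omega>\<bar> \<le> 2 ^ n0" unfolding n0_def using n by (rule LeastI)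
    have "n0 \<noteq> 0" using n0 False by (intro notI) simp
    then obtain j where j: "n0 = Suc j" by (cases n0) auto
    have "\<not> \<bar>Z \<omega>\<bar> \<le> 2 ^ j"
      using not_less_Least[of j "\<lambda>n. \<bar>Z \<omega>\<bar> \<le> 2 ^ n"] j by (simp add: n0_def)
    hence "\<omega> \<in> B j" using that by (simp add: B_def)
    have "\<bar>Z \<omega>\<bar> powr q \<le> (2 ^ Suc j) powr q" using n0 j q by (intro powr_mono2) auto
    also have "\<dots> = 2 powr ((real j + 1) * q)"
      by (simp only: powr_realpow[symmetric, of 2] zero_less_numeral powr_powr) (simp add: add.commute)
    finally have "ennreal (\<bar>Z \<omega>\<bar> powr q) \<le> ennreal (2 powr ((real j + 1) * q)) * indicator (B j) \<omega>"
      using \<open>\<omega> \<in> B j\<close> by (simp add: ennreal_leI)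
    also have "\<dots> \<le> (\<Sum>j. ennreal (2 powr ((real j + 1) * q)) * indicator (B j) \<omega>)"
    proof -
      have "f j \<le> suminf f" for f :: "nat \<Rightarrow> ennreal" using sum_le_suminf[of f "{j}"] by simp
      thus ?thesis .
    qed
    finally show ?thesis by (simp add: add_increasing)
  qed
  have "(\<integral>\<^sup>+\<omega>. ennreal (\<bar>Z \<omega>\<bar> powr q) \<partial>M)
      \<le> (\<integral>\<^sup>+\<omega>. 1 + (\<Sum>j. ennreal (2 powr ((real j + 1) * q)) * indicator (B j) \<omega>) \<partial>M)"
    by (intro nn_integral_mono pw)
  also have "\<dots> = 1 + (\<Sum>j. ennreal (2 powr ((real j + 1) * q)) * emeasure M (B j))"
    by (simp add: nn_integral_add nn_integral_suminf nn_integral_cmult emeasure_space_1)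
  also have "\<dots> \<le> 1 + (\<Sum>j. ennreal (w j))"
    by (intro add_left_mono suminf_le w) auto
  also have "\<dots> = 1 + ennreal (suminf w)"
    using suminf_ennreal2[OF w0 \<open>summable w\<close>] by simp
  also have "\<dots> < \<infinity>" by (simp add: ennreal_add_eq_top less_top)
  finally show ?thesis
    by (intro integrableI_bounded) auto
qed

subsection \<open>Weights with polynomial decay\<close>

text \<open>Translating by \<open>k\<close> makes the bound independent of \<open>k\<close>. On each
  half line the map to \<open>\<bar>l\<bar>\<close> is injective, so both halves are bounded by one
  series over the naturals.\<close>

lemma sum_int_powr_bounded:
  fixes s :: real
  assumes "1 < s"
  obtains K where "0 \<le> K" "\<And>k I. finite I \<Longrightarrow> (\<Sum>l\<in>I. (1 + \<bar>real_of_int (k - l)\<bar>) powr (- s)) \<le> K"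
proof -
  define g where "g n = (1 + real n) powr (- s)" for n
  have "summable (\<lambda>n. real n powr (- s))" using assms by (simp add: summable_real_powr_iff)
  hence "summable (\<lambda>n. real (Suc n) powr (- s))" by (subst summable_Suc_iff)
  hence g: "summable g" by (simp add: g_def[abs_def])
  have half: "(\<Sum>l\<in>A. g (nat \<bar>l\<bar>)) \<le> suminf g" if "finite A" "inj_on (\<lambda>l. nat \<bar>l\<bar>) A" for A :: "int set"
  proof -
    have "(\<Sum>l\<in>A. g (nat \<bar>l\<bar>)) = (\<Sum>n\<in>(\<lambda>l. nat \<bar>l\<bar>) ` A. g n)"
      using that by (simp add: sum.reindex)
    also have "\<dots> \<le> suminf g"
      using that by (intro sum_le_suminf g) (auto simp: g_def)
    finally show ?thesis .
  qed
  show ?thesis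
  proof (rule that[of "2 * suminf g"])
    show "0 \<le> 2 * suminf g" using g by (simp add: suminf_nonneg g_def)
    fix k :: int and I :: "int set" assume I: "finite I"
    define J where "J = (\<lambda>l. k - l) ` I"
    have J: "finite J" using I by (simp add: J_def)
    have "(\<Sum>l\<in>I. (1 + \<bar>real_of_int (k - l)\<bar>) powr (- s)) = (\<Sum>l\<in>J. g (nat \<bar>l\<bar>))"
      unfolding J_def by (subst sum.reindex) (auto simp: inj_on_def g_def)
    also have "\<dots> = (\<Sum>l\<in>J \<inter> {0..}. g (nat \<bar>l\<bar>)) + (\<Sum>l\<in>J \<inter> {..<0}. g (nat \<bar>l\<bar>))"
      using J by (subst sum.union_disjoint[symmetric]) (auto intro!: sum.cong)
    also have "\<dots> \<le> suminf g + suminf g"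
      using J by (intro add_mono half) (auto simp: inj_on_def)
    finally show "(\<Sum>l\<in>I. (1 + \<bar>real_of_int (k - l)\<bar>) powr (- s)) \<le> 2 * suminf g" by simp
  qed
qed

lemma decay_bound:
  fixes c :: "int \<Rightarrow> real"
  assumes "\<exists>C. \<forall>l. \<bar>real_of_int l\<bar> powr s * \<bar>c l\<bar> \<le> C" and s: "0 \<le> s"
  obtains A where "0 \<le> A" "\<And>l. \<bar>c l\<bar> \<le> A * (1 + \<bar>real_of_int l\<bar>) powr (- s)"
proof -
  obtain C where C: "\<And>l. \<bar>real_of_int l\<bar> powr s * \<bar>c l\<bar> \<le> C" using assms by blast
  \<comment> \<open>For \<open>l \<noteq> 0\<close> one has
    \<open>1 + \<bar>l\<bar> \<le> 2 * \<bar>l\<bar>\<close>, whence \<open>2 powr s\<close>. The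
    hypothesis is silent about \<open>c 0\<close>, as the weight \<open>\<bar>l\<bar> powr s\<close>
    vanishes there; the maximum takes care of it.\<close>
  define A where "A = max (2 powr s * C) \<bar>c 0\<bar>"
  show ?thesis
  proof (rule that[of A])
    show "0 \<le> A" unfolding A_def by simp
    fix l :: int
    have "(1 + \<bar>real_of_int l\<bar>) powr s * \<bar>c l\<bar> \<le> A"
    proof (cases "l = 0")
      case False
      hence "(1 + \<bar>real_of_int l\<bar>) powr s \<le> (2 * \<bar>real_of_int l\<bar>) powr s"
        using s by (intro powr_mono2) auto
      hence "(1 + \<bar>real_of_int l\<bar>) powr s * \<bar>c l\<bar> \<le> 2 powr s * (\<bar>real_of_int l\<bar> powr s * \<bar>c l\<bar>)"
        by (simp add: powr_mult mult_right_mono flip: mult.assoc)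
      also have "\<dots> \<le> 2 powr s * C" by (intro mult_left_mono C) auto
      finally show ?thesis by (simp add: A_def)
    qed (simp add: A_def)
    thus "\<bar>c l\<bar> \<le> A * (1 + \<bar>real_of_int l\<bar>) powr (- s)"
      by (simp add: powr_minus field_simps)
  qed
qed

text \<open>The larger of \<open>x\<close> and \<open>y\<close> is at least \<open>h / 2\<close> and
  supplies the decay in \<open>h\<close> of order \<open>t = 2 * s - 1 - e\<close>. Its remaining
  exponent \<open>s - t = 1 + e - s\<close> is nonnegative and is handed to the smaller variable,
  which then has the summable exponent \<open>1 + e\<close>.\<close>

lemma powr_mult_le_of_add_ge:
  fixes x y h s e :: real
  assumes "0 \<le> x" "0 \<le> y" "0 \<le> h" "h \<le> x + y" "s \<le> 1" "0 < e" "e \<le> 2 * s - 1"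
  shows "(1 + x) powr (- s) * (1 + y) powr (- s)
    \<le> 2 powr (2 * s - 1 - e) * (1 + h) powr (- (2 * s - 1 - e)) * ((1 + x) powr (- (1 + e)) + (1 + y) powr (- (1 + e)))"
proof -
  define t where "t = 2 * s - 1 - e"
  have *: "(1 + x) powr (- s) * (1 + y) powr (- s) \<le> 2 powr t * (1 + h) powr (- t) * (1 + x) powr (- (1 + e))"
    if "0 \<le> x" "x \<le> y" "h \<le> x + y" for x y
  proof -
    have "(1 + y) powr (- s) = (1 + y) powr (- t) * (1 + y) powr (- (s - t))"
      by (simp flip: powr_add)
    also have "\<dots> \<le> ((1 + h) / 2) powr (- t) * (1 + x) powr (- (s - t))"
      using that assms by (intro mult_mono powr_mono2') (auto simp: t_def)
    finally have "(1 + x) powr (- s) * (1 + y) powr (- s)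
        \<le> (1 + x) powr (- s) * (((1 + h) / 2) powr (- t) * (1 + x) powr (- (s - t)))"
      by (intro mult_left_mono) auto
    also have "\<dots> = ((1 + h) / 2) powr (- t) * ((1 + x) powr (- s) * (1 + x) powr (- (s - t)))"
      by (simp add: mult_ac)
    also have "(1 + x) powr (- s) * (1 + x) powr (- (s - t)) = (1 + x) powr (- (1 + e))"
      by (simp add: t_def flip: powr_add)
    also have "((1 + h) / 2) powr (- t) = 2 powr t * (1 + h) powr (- t)"
      using assms by (simp add: powr_divide powr_minus field_simps)
    finally show ?thesis .
  qed
  have p: "0 \<le> 2 powr t * (1 + h) powr (- t) * (1 + z) powr (- (1 + e))" for z by simp
  show ?thesis
  proof (cases "x \<le> y")
    case True
    from *[OF assms(1) this assms(4)] p[of y] show ?thesis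
      unfolding t_def[symmetric] distrib_left by linarith
  next
    case False
    hence "(1 + y) powr (- s) * (1 + x) powr (- s) \<le> 2 powr t * (1 + h) powr (- t) * (1 + y) powr (- (1 + e))"
      using assms by (intro *) auto
    with p[of x] show ?thesis
      unfolding t_def[symmetric] distrib_left mult.commute[of "(1 + x) powr - s"] by linarith
  qed
qed

text \<open>The pointwise bound is used with \<open>x\<close>, \<open>y\<close>, \<open>h\<close>
  the distances between \<open>k\<close>, \<open>k'\<close> and \<open>l\<close>. Giving up
  \<open>e\<close> in the decay buys summability and absorbs the logarithm that appears at
  \<open>s = 1\<close>.\<close>

lemma convolution_bound:
  fixes s e :: real
  assumes "s \<le> 1" "0 < e" "e \<le> 2 * s - 1"
  obtains K where "0 \<le> K"
    "\<And>k k' I. finite I \<Longrightarrow> (\<Sum>l\<in>I. (1 + \<bar>real_of_int (k - l)\<bar>) powr (- s) * (1 + \<bar>real_of_int (k' - l)\<bar>) powr (- s))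
      \<le> K * (1 + \<bar>real_of_int (k - k')\<bar>) powr (- (2 * s - 1 - e))"
proof -
  obtain K where K: "0 \<le> K"
    "\<And>k I. finite I \<Longrightarrow> (\<Sum>l\<in>I. (1 + \<bar>real_of_int (k - l)\<bar>) powr (- (1 + e))) \<le> K"
    using sum_int_powr_bounded[of "1 + e"] assms by auto
  show ?thesis
  proof (rule that[of "2 powr (2 * s - 1 - e) * (2 * K)"])
    show "0 \<le> 2 powr (2 * s - 1 - e) * (2 * K)" using K by simp
    fix k k' :: int and I :: "int set" assume I: "finite I"
    let ?D = "2 powr (2 * s - 1 - e) * (1 + \<bar>real_of_int (k - k')\<bar>) powr (- (2 * s - 1 - e))"
    have "(\<Sum>l\<in>I. (1 + \<bar>real_of_int (k - l)\<bar>) powr (- s) * (1 + \<bar>real_of_int (k' - l)\<bar>) powr (- s))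
      \<le> (\<Sum>l\<in>I. ?D * ((1 + \<bar>real_of_int (k - l)\<bar>) powr (- (1 + e)) + (1 + \<bar>real_of_int (k' - l)\<bar>) powr (- (1 + e))))"
      using assms by (intro sum_mono powr_mult_le_of_add_ge) auto
    also have "\<dots> = ?D * ((\<Sum>l\<in>I. (1 + \<bar>real_of_int (k - l)\<bar>) powr (- (1 + e)))
        + (\<Sum>l\<in>I. (1 + \<bar>real_of_int (k' - l)\<bar>) powr (- (1 + e))))"
      by (simp add: sum_distrib_left sum.distrib distrib_left)
    also have "\<dots> \<le> ?D * (K + K)"
      using I by (intro mult_left_mono add_mono K) auto
    finally show "(\<Sum>l\<in>I. (1 + \<bar>real_of_int (k - l)\<bar>) powr (- s) * (1 + \<bar>real_of_int (k' - l)\<bar>) powr (- s))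
      \<le> 2 powr (2 * s - 1 - e) * (2 * K) * (1 + \<bar>real_of_int (k - k')\<bar>) powr (- (2 * s - 1 - e))"
      by (simp add: mult_ac)
  qed
qed

text \<open>Inside the window \<open>1 + \<bar>k - k'\<bar> \<le> n\<close>, so a power
  \<open>\<gamma> - 1\<close> of the distance can be traded for
  \<open>n powr (\<gamma> - 1)\<close>. What remains has exponent above 1 and sums to a constant for
  each \<open>k\<close>. This treats small and large \<open>\<theta>\<close> alike.\<close>

lemma window_double_sum_bound:
  fixes \<theta> \<gamma> :: real
  assumes "1 \<le> \<gamma>" "2 < \<theta> + \<gamma>"
  obtains K where "0 \<le> K"
    "\<And>a n. (\<Sum>k\<in>{a<..a + int n}. \<Sum>k'\<in>{a<..a + int n}. (1 + \<bar>real_of_int (k - k')\<bar>) powr (- \<theta>)) \<le> K * real n powr \<gamma>"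
proof -
  obtain K where K: "0 \<le> K"
    "\<And>k I. finite I \<Longrightarrow> (\<Sum>l\<in>I. (1 + \<bar>real_of_int (k - l)\<bar>) powr (- (\<theta> + \<gamma> - 1))) \<le> K"
    using sum_int_powr_bounded[of "\<theta> + \<gamma> - 1"] assms by auto
  show ?thesis
  proof (rule that[OF K(1)])
    fix a :: int and n :: nat
    have *: "(1 + \<bar>real_of_int (k - k')\<bar>) powr (- \<theta>) \<le> real n powr (\<gamma> - 1) * (1 + \<bar>real_of_int (k - k')\<bar>) powr (- (\<theta> + \<gamma> - 1))"
      if "k \<in> {a<..a + int n}" "k' \<in> {a<..a + int n}" for k k'
    proof -
      have "1 + \<bar>k - k'\<bar> \<le> int n" using that by auto
      hence le: "1 + \<bar>real_of_int (k - k')\<bar> \<le> real n" by linarith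
      have "(1 + \<bar>real_of_int (k - k')\<bar>) powr (- \<theta>)
          = (1 + \<bar>real_of_int (k - k')\<bar>) powr (\<gamma> - 1) * (1 + \<bar>real_of_int (k - k')\<bar>) powr (- (\<theta> + \<gamma> - 1))"
        by (simp flip: powr_add)
      also have "\<dots> \<le> real n powr (\<gamma> - 1) * (1 + \<bar>real_of_int (k - k')\<bar>) powr (- (\<theta> + \<gamma> - 1))"
        using le assms by (intro mult_right_mono powr_mono2) auto
      finally show ?thesis .
    qed
    have "(\<Sum>k\<in>{a<..a + int n}. \<Sum>k'\<in>{a<..a + int n}. (1 + \<bar>real_of_int (k - k')\<bar>) powr (- \<theta>))
      \<le> (\<Sum>k\<in>{a<..a + int n}. \<Sum>k'\<in>{a<..a + int n}. real n powr (\<gamma> - 1) * (1 + \<bar>real_of_int (k - k')\<bar>) powr (- (\<theta> + \<gamma> - 1)))"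
      by (intro sum_mono *)
    also have "\<dots> = (\<Sum>k\<in>{a<..a + int n}. real n powr (\<gamma> - 1) * (\<Sum>k'\<in>{a<..a + int n}. (1 + \<bar>real_of_int (k - k')\<bar>) powr (- (\<theta> + \<gamma> - 1))))"
      by (simp add: sum_distrib_left)
    also have "\<dots> \<le> (\<Sum>k\<in>{a<..a + int n}. real n powr (\<gamma> - 1) * K)"
      by (intro sum_mono mult_left_mono K) auto
    also have "\<dots> = K * (real n * real n powr (\<gamma> - 1))" by simp
    also have "real n * real n powr (\<gamma> - 1) = real n powr \<gamma>"
      by (cases "n = 0") (simp_all add: powr_diff)
    finally show "(\<Sum>k\<in>{a<..a + int n}. \<Sum>k'\<in>{a<..a + int n}. (1 + \<bar>real_of_int (k - k')\<bar>) powr (- \<theta>)) \<le> K * real n powr \<gamma>" .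
  qed
qed

text \<open>The two sums differ by a reflection. The one over \<open>l\<close> controls the process
  at one time, the one over \<open>k\<close> the weight that one variable receives from a
  window.\<close>

lemma sum_abs_shift_bound:
  fixes a :: "int \<Rightarrow> real"
  assumes s: "1 < s" and A: "0 \<le> A" "\<And>l. \<bar>a l\<bar> \<le> A * (1 + \<bar>real_of_int l\<bar>) powr (- s)"
  obtains K where "0 \<le> K" "\<And>k I. finite I \<Longrightarrow> (\<Sum>l\<in>I. \<bar>a (k - l)\<bar>) \<le> K"
    "\<And>l I. finite I \<Longrightarrow> (\<Sum>k\<in>I. \<bar>a (k - l)\<bar>) \<le> K"
proof -
  obtain K where K: "0 \<le> K"
    "\<And>k I. finite I \<Longrightarrow> (\<Sum>l\<in>I. (1 + \<bar>real_of_int (k - l)\<bar>) powr (- s)) \<le> K"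
    using sum_int_powr_bounded[OF s] by auto
  show ?thesis
  proof (rule that[of "A * K"])
    show "0 \<le> A * K" using A K by simp
    fix k :: int and I :: "int set" assume I: "finite I"
    have "(\<Sum>l\<in>I. \<bar>a (k - l)\<bar>) \<le> (\<Sum>l\<in>I. A * (1 + \<bar>real_of_int (k - l)\<bar>) powr (- s))"
      by (intro sum_mono A)
    also have "\<dots> \<le> A * K" unfolding sum_distrib_left[symmetric] using I A by (intro mult_left_mono K)
    finally show "(\<Sum>l\<in>I. \<bar>a (k - l)\<bar>) \<le> A * K" .
    have "(\<Sum>l\<in>I. \<bar>a (l - k)\<bar>) \<le> (\<Sum>l\<in>I. A * (1 + \<bar>real_of_int (l - k)\<bar>) powr (- s))"
      by (intro sum_mono A)
    also have "\<dots> = (\<Sum>l\<in>I. A * (1 + \<bar>real_of_int (k - l)\<bar>) powr (- s))"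
      by (simp add: abs_minus_commute)
    also have "\<dots> \<le> A * K" unfolding sum_distrib_left[symmetric] using I A by (intro mult_left_mono K)
    finally show "(\<Sum>l\<in>I. \<bar>a (l - k)\<bar>) \<le> A * K" .
  qed
qed

text \<open>Interpolation between the supremum and the sum: window weights are bounded by
  \<open>K\<close>, so \<open>q - 1\<close> of the powers are free, and their absolute values add up
  to at most \<open>K\<close> for each of the \<open>n\<close> times.\<close>

lemma diagonal_weight_bound:
  fixes a :: "int \<Rightarrow> real"
  assumes s: "1 < s" and A: "0 \<le> A" "\<And>l. \<bar>a l\<bar> \<le> A * (1 + \<bar>real_of_int l\<bar>) powr (- s)" and q: "1 \<le> q"
  obtains K where "0 \<le> K"
    "\<And>b n I. finite I \<Longrightarrow> (\<Sum>l\<in>I. \<bar>\<Sum>k\<in>{b<..b + int n}. a (k - l)\<bar> powr q) \<le> K * real n"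
proof -
  obtain K where K: "0 \<le> K" "\<And>k I. finite I \<Longrightarrow> (\<Sum>l\<in>I. \<bar>a (k - l)\<bar>) \<le> K"
    "\<And>l I. finite I \<Longrightarrow> (\<Sum>k\<in>I. \<bar>a (k - l)\<bar>) \<le> K"
    using sum_abs_shift_bound[OF s A] by metis
  show ?thesis
  proof (rule that[of "K powr (q - 1) * K"])
    show "0 \<le> K powr (q - 1) * K" using K by simp
    fix b :: int and n :: nat and I :: "int set" assume I: "finite I"
    define w where "w l = (\<Sum>k\<in>{b<..b + int n}. a (k - l))" for l
    have w: "\<bar>w l\<bar> \<le> (\<Sum>k\<in>{b<..b + int n}. \<bar>a (k - l)\<bar>)" for l
      unfolding w_def by (rule sum_abs)
    have wq: "\<bar>w l\<bar> powr q \<le> K powr (q - 1) * \<bar>w l\<bar>" for l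
    proof -
      have "\<bar>w l\<bar> powr q = \<bar>w l\<bar> powr (q - 1) * \<bar>w l\<bar>"
        by (cases "w l = 0") (simp_all add: powr_diff)
      also have "\<dots> \<le> K powr (q - 1) * \<bar>w l\<bar>"
        using q order_trans[OF w K(3)[of "{b<..b + int n}" l]] by (intro mult_right_mono powr_mono2) auto
      finally show ?thesis .
    qed
    have "(\<Sum>l\<in>I. \<bar>w l\<bar>) \<le> (\<Sum>l\<in>I. \<Sum>k\<in>{b<..b + int n}. \<bar>a (k - l)\<bar>)"
      by (intro sum_mono w)
    also have "\<dots> = (\<Sum>k\<in>{b<..b + int n}. \<Sum>l\<in>I. \<bar>a (k - l)\<bar>)" by (rule sum.swap)
    also have "\<dots> \<le> (\<Sum>k\<in>{b<..b + int n}. K)" using I by (intro sum_mono K)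
    finally have w1: "(\<Sum>l\<in>I. \<bar>w l\<bar>) \<le> K * real n" by (simp add: mult.commute)
    have "(\<Sum>l\<in>I. \<bar>w l\<bar> powr q) \<le> K powr (q - 1) * (\<Sum>l\<in>I. \<bar>w l\<bar>)"
      unfolding sum_distrib_left by (intro sum_mono wq)
    also have "\<dots> \<le> K powr (q - 1) * (K * real n)"
      using w1 by (intro mult_left_mono) auto
    finally show "(\<Sum>l\<in>I. \<bar>\<Sum>k\<in>{b<..b + int n}. a (k - l)\<bar> powr q) \<le> K powr (q - 1) * K * real n"
      unfolding w_def by (simp add: mult.assoc)
  qed
qed

text \<open>Expanding the square and summing over \<open>l\<close> and \<open>m\<close> before
  \<open>k\<close> and \<open>k'\<close> makes the expression factor into correlations of
  \<open>c\<close> with itself and of \<open>c'\<close> with itself. Each decays in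
  \<open>k - k'\<close>, and the product of the two bounds is summed over the window.\<close>

lemma offdiagonal_weight_bound:
  fixes c c' :: "int \<Rightarrow> real"
  assumes s: "1/2 < s" "s \<le> 1" and s': "1/2 < s'" "s' \<le> 1"
    and A: "0 \<le> A" "\<And>l. \<bar>c l\<bar> \<le> A * (1 + \<bar>real_of_int l\<bar>) powr (- s)"
    and A': "0 \<le> A'" "\<And>l. \<bar>c' l\<bar> \<le> A' * (1 + \<bar>real_of_int l\<bar>) powr (- s')"
    and \<gamma>: "1 \<le> \<gamma>" "2 * (2 - s - s') < \<gamma>"
  obtains K where "0 \<le> K"
    "\<And>b n I. finite I \<Longrightarrow> (\<Sum>l\<in>I. \<Sum>m\<in>I. (\<Sum>k\<in>{b<..b + int n}. c (k - l) * c' (k - m))\<^sup>2) \<le> K * real n powr \<gamma>"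
proof -
  \<comment> \<open>The loss \<open>e\<close> occurs once in each factor of \<open>\<theta>\<close>;
    a quarter of the gap leaves \<open>2 * e\<close> below the gap, which is exactly
    \<open>2 < \<theta> + \<gamma>\<close>.\<close>
  define e where "e = min (min (2 * s - 1) (2 * s' - 1)) ((\<gamma> - 2 * (2 - s - s')) / 4)"
  have e: "0 < e" "e \<le> 2 * s - 1" "e \<le> 2 * s' - 1" "e \<le> (\<gamma> - 2 * (2 - s - s')) / 4"
    using s s' \<gamma> unfolding e_def by (auto simp: min_def)
  define \<theta> where "\<theta> = (2 * s - 1 - e) + (2 * s' - 1 - e)"
  have \<theta>: "2 < \<theta> + \<gamma>" using e \<gamma> unfolding \<theta>_def by argo
  have conv: "\<exists>K\<ge>0. \<forall>k k' I. finite I \<longrightarrow> \<bar>\<Sum>l\<in>I. c (k - l) * c (k' - l)\<bar> \<le> K * (1 + \<bar>real_of_int (k - k')\<bar>) powr (- (2 * s - 1 - e))"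
    if s: "s \<le> 1" "e \<le> 2 * s - 1" and A: "0 \<le> A" "\<And>l. \<bar>c l\<bar> \<le> A * (1 + \<bar>real_of_int l\<bar>) powr (- s)"
    for c :: "int \<Rightarrow> real" and s A :: real
  proof -
    obtain K where K: "0 \<le> K"
      "\<And>k k' I. finite I \<Longrightarrow> (\<Sum>l\<in>I. (1 + \<bar>real_of_int (k - l)\<bar>) powr (- s) * (1 + \<bar>real_of_int (k' - l)\<bar>) powr (- s))
        \<le> K * (1 + \<bar>real_of_int (k - k')\<bar>) powr (- (2 * s - 1 - e))"
      using convolution_bound[of s e] s e(1) by blast
    have "\<bar>\<Sum>l\<in>I. c (k - l) * c (k' - l)\<bar> \<le> (A * A * K) * (1 + \<bar>real_of_int (k - k')\<bar>) powr (- (2 * s - 1 - e))"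
      if I: "finite I" for k k' I
    proof -
      have "\<bar>\<Sum>l\<in>I. c (k - l) * c (k' - l)\<bar> \<le> (\<Sum>l\<in>I. \<bar>c (k - l)\<bar> * \<bar>c (k' - l)\<bar>)"
        by (metis (no_types, lifting) abs_mult sum.cong sum_abs)
      also have "\<dots> \<le> (\<Sum>l\<in>I. (A * (1 + \<bar>real_of_int (k - l)\<bar>) powr (- s)) * (A * (1 + \<bar>real_of_int (k' - l)\<bar>) powr (- s)))"
        by (intro sum_mono mult_mono A(2)) (use A(1) in auto)
      also have "\<dots> = A * A * (\<Sum>l\<in>I. (1 + \<bar>real_of_int (k - l)\<bar>) powr (- s) * (1 + \<bar>real_of_int (k' - l)\<bar>) powr (- s))"
        by (simp add: sum_distrib_left mult_ac)
      also have "\<dots> \<le> A * A * (K * (1 + \<bar>real_of_int (k - k')\<bar>) powr (- (2 * s - 1 - e)))"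
        using A I by (intro mult_left_mono K) auto
      finally show ?thesis by (simp add: mult_ac)
    qed
    thus ?thesis using A K by (intro exI[of _ "A * A * K"]) auto
  qed
  obtain K1 where K1: "0 \<le> K1" "\<And>k k' I. finite I \<Longrightarrow>
      \<bar>\<Sum>l\<in>I. c (k - l) * c (k' - l)\<bar> \<le> K1 * (1 + \<bar>real_of_int (k - k')\<bar>) powr (- (2 * s - 1 - e))"
    using conv[OF s(2) e(2) A] by blast
  obtain K2 where K2: "0 \<le> K2" "\<And>k k' I. finite I \<Longrightarrow>
      \<bar>\<Sum>l\<in>I. c' (k - l) * c' (k' - l)\<bar> \<le> K2 * (1 + \<bar>real_of_int (k - k')\<bar>) powr (- (2 * s' - 1 - e))"
    using conv[OF s'(2) e(3) A'] by blast
  obtain K3 where K3: "0 \<le> K3"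
    "\<And>a n. (\<Sum>k\<in>{a<..a + int n}. \<Sum>k'\<in>{a<..a + int n}. (1 + \<bar>real_of_int (k - k')\<bar>) powr (- \<theta>)) \<le> K3 * real n powr \<gamma>"
    using window_double_sum_bound[OF \<gamma>(1) \<theta>] by blast
  show ?thesis
  proof (rule that[of "K1 * K2 * K3"])
    show "0 \<le> K1 * K2 * K3" using K1 K2 K3 by simp
    fix b :: int and n :: nat and I :: "int set" assume I: "finite I"
    let ?W = "{b<..b + int n}"
    have "(\<Sum>l\<in>I. \<Sum>m\<in>I. (\<Sum>k\<in>?W. c (k - l) * c' (k - m))\<^sup>2)
        = (\<Sum>l\<in>I. \<Sum>m\<in>I. \<Sum>k\<in>?W. \<Sum>k'\<in>?W. (c (k - l) * c (k' - l)) * (c' (k - m) * c' (k' - m)))"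
      unfolding power2_eq_square sum_product by (simp add: mult_ac)
    also have "\<dots> = (\<Sum>l\<in>I. \<Sum>k\<in>?W. \<Sum>m\<in>I. \<Sum>k'\<in>?W. (c (k - l) * c (k' - l)) * (c' (k - m) * c' (k' - m)))"
      by (rule sum.cong[OF refl], rule sum.swap)
    also have "\<dots> = (\<Sum>l\<in>I. \<Sum>k\<in>?W. \<Sum>k'\<in>?W. \<Sum>m\<in>I. (c (k - l) * c (k' - l)) * (c' (k - m) * c' (k' - m)))"
      by (rule sum.cong[OF refl], rule sum.cong[OF refl], rule sum.swap)
    also have "\<dots> = (\<Sum>k\<in>?W. \<Sum>l\<in>I. \<Sum>k'\<in>?W. \<Sum>m\<in>I. (c (k - l) * c (k' - l)) * (c' (k - m) * c' (k' - m)))"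
      by (rule sum.swap)
    also have "\<dots> = (\<Sum>k\<in>?W. \<Sum>k'\<in>?W. \<Sum>l\<in>I. \<Sum>m\<in>I. (c (k - l) * c (k' - l)) * (c' (k - m) * c' (k' - m)))"
      by (rule sum.cong[OF refl], rule sum.swap)
    also have "\<dots> = (\<Sum>k\<in>?W. \<Sum>k'\<in>?W. (\<Sum>l\<in>I. c (k - l) * c (k' - l)) * (\<Sum>m\<in>I. c' (k - m) * c' (k' - m)))"
      by (simp only: sum_product)
    finally have eq: "(\<Sum>l\<in>I. \<Sum>m\<in>I. (\<Sum>k\<in>?W. c (k - l) * c' (k - m))\<^sup>2)
        = (\<Sum>k\<in>?W. \<Sum>k'\<in>?W. (\<Sum>l\<in>I. c (k - l) * c (k' - l)) * (\<Sum>m\<in>I. c' (k - m) * c' (k' - m)))" .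
    have "(\<Sum>k\<in>?W. \<Sum>k'\<in>?W. (\<Sum>l\<in>I. c (k - l) * c (k' - l)) * (\<Sum>m\<in>I. c' (k - m) * c' (k' - m)))
        \<le> (\<Sum>k\<in>?W. \<Sum>k'\<in>?W. K1 * K2 * (1 + \<bar>real_of_int (k - k')\<bar>) powr (- \<theta>))"
    proof (rule sum_mono, rule sum_mono)
      fix k k'
      have "(\<Sum>l\<in>I. c (k - l) * c (k' - l)) * (\<Sum>m\<in>I. c' (k - m) * c' (k' - m))
         \<le> \<bar>\<Sum>l\<in>I. c (k - l) * c (k' - l)\<bar> * \<bar>\<Sum>m\<in>I. c' (k - m) * c' (k' - m)\<bar>"
        unfolding abs_mult[symmetric] by (rule abs_ge_self)
      also have "\<dots> \<le> (K1 * (1 + \<bar>real_of_int (k - k')\<bar>) powr (- (2 * s - 1 - e)))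
          * (K2 * (1 + \<bar>real_of_int (k - k')\<bar>) powr (- (2 * s' - 1 - e)))"
        using K1 K2 I by (intro mult_mono) auto
      also have "\<dots> = K1 * K2 * ((1 + \<bar>real_of_int (k - k')\<bar>) powr (- (2 * s - 1 - e))
          * (1 + \<bar>real_of_int (k - k')\<bar>) powr (- (2 * s' - 1 - e)))"
        by (simp add: mult_ac)
      also have "(1 + \<bar>real_of_int (k - k')\<bar>) powr (- (2 * s - 1 - e))
          * (1 + \<bar>real_of_int (k - k')\<bar>) powr (- (2 * s' - 1 - e)) = (1 + \<bar>real_of_int (k - k')\<bar>) powr (- \<theta>)"
        unfolding \<theta>_def minus_add_distrib by (rule powr_add[symmetric])
      finally show "(\<Sum>l\<in>I. c (k - l) * c (k' - l)) * (\<Sum>m\<in>I. c' (k - m) * c' (k' - m))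
          \<le> K1 * K2 * (1 + \<bar>real_of_int (k - k')\<bar>) powr (- \<theta>)" .
    qed
    also have "\<dots> = K1 * K2 * (\<Sum>k\<in>?W. \<Sum>k'\<in>?W. (1 + \<bar>real_of_int (k - k')\<bar>) powr (- \<theta>))"
      by (simp add: sum_distrib_left)
    also have "\<dots> \<le> K1 * K2 * (K3 * real n powr \<gamma>)"
      using K1 K2 by (intro mult_left_mono K3) auto
    finally show "(\<Sum>l\<in>I. \<Sum>m\<in>I. (\<Sum>k\<in>?W. c (k - l) * c' (k - m))\<^sup>2) \<le> K1 * K2 * K3 * real n powr \<gamma>"
      unfolding eq by (simp add: mult.assoc)
  qed
qed

text \<open>Absolute summability makes the unordered sum invariant under
  \<open>l \<mapsto> k - l\<close>, and symmetric intervals exhaust the integers. It identifies the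
  limit of the truncated centring terms, whatever \<open>k\<close> is.\<close>

lemma symmetric_sums_tendsto_infsum:
  fixes a :: "int \<Rightarrow> real"
  assumes K: "\<And>I. finite I \<Longrightarrow> (\<Sum>l\<in>I. \<bar>a l\<bar>) \<le> K"
  shows "(\<lambda>n::nat. \<Sum>l\<in>{- int n..int n}. a (k - l)) \<longlonglongrightarrow> infsum a UNIV"
proof -
  have "(\<lambda>l. norm (a l)) summable_on UNIV"
    by (rule nonneg_bdd_above_summable_on) (auto intro!: bdd_aboveI2[where M = K] K)
  hence "(a has_sum infsum a UNIV) UNIV"
    using abs_summable_summable by (blast intro: has_sum_infsum)
  hence "((\<lambda>l. a (k - l)) has_sum infsum a UNIV) UNIV"
    by (subst has_sum_reindex_bij_betw[of "\<lambda>l. k - l" UNIV UNIV])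
      (auto intro!: bij_betwI[of _ _ _ "\<lambda>l. k - l"])
  hence lim: "(sum (\<lambda>l. a (k - l)) \<longlongrightarrow> infsum a UNIV) (finite_subsets_at_top UNIV)"
    by (simp add: has_sum_def)
  have "filterlim (\<lambda>n::nat. {- int n..int n}) (finite_subsets_at_top UNIV) sequentially"
    unfolding filterlim_finite_subsets_at_top
  proof (intro allI impI)
    fix J :: "int set" assume J: "finite J \<and> J \<subseteq> UNIV"
    \<comment> \<open>A convenient bound for all absolute values in \<open>J\<close>, valid for
      empty \<open>J\<close> too.\<close>
    define m where "m = nat (\<Sum>j\<in>J. \<bar>j\<bar>)"
    have "\<bar>j\<bar> \<le> int m" if "j \<in> J" for j
      using member_le_sum[of j J abs] that J by (simp add: m_def sum_nonneg)
    hence "J \<subseteq> {- int n..int n}" if "m \<le> n" for n using that by fastforce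
    thus "\<forall>\<^sub>F n in sequentially. finite {- int n..int n} \<and> J \<subseteq> {- int n..int n} \<and> {- int n..int n} \<subseteq> UNIV"
      by (auto intro!: eventually_sequentiallyI[of m])
  qed
  from filterlim_compose[OF lim this] show ?thesis .
qed

text \<open>From \<open>\<bar>l\<bar> \<le> (1 + \<bar>k\<bar>) * (1 + \<bar>k - l\<bar>)\<close>.
  The constant depends on \<open>k\<close>, which is harmless: it only serves almost sure
  convergence for each fixed \<open>k\<close>.\<close>

lemma shifted_decay_bound:
  fixes c :: "int \<Rightarrow> real"
  assumes s: "0 \<le> s" and A: "0 \<le> A" "\<And>l. \<bar>c l\<bar> \<le> A * (1 + \<bar>real_of_int l\<bar>) powr (- s)"
  shows "\<bar>real_of_int l\<bar> powr s * \<bar>c (k - l)\<bar> \<le> (1 + \<bar>real_of_int k\<bar>) powr s * A"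
proof -
  let ?y = "1 + \<bar>real_of_int (k - l)\<bar>"
  have "\<bar>real_of_int l\<bar> \<le> \<bar>real_of_int k\<bar> + \<bar>real_of_int (k - l)\<bar>" by simp
  also have "\<dots> \<le> (1 + \<bar>real_of_int k\<bar>) * ?y" by (simp add: distrib_left distrib_right)
  finally have "\<bar>real_of_int l\<bar> powr s \<le> ((1 + \<bar>real_of_int k\<bar>) * ?y) powr s"
    using s by (intro powr_mono2) auto
  also have "\<dots> = (1 + \<bar>real_of_int k\<bar>) powr s * ?y powr s" by (simp add: powr_mult)
  finally have "\<bar>real_of_int l\<bar> powr s * \<bar>c (k - l)\<bar>
      \<le> ((1 + \<bar>real_of_int k\<bar>) powr s * ?y powr s) * (A * ?y powr (- s))"
    by (intro mult_mono A(2)) (use A(1) in auto)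
  also have "\<dots> = (1 + \<bar>real_of_int k\<bar>) powr s * A * (?y powr s * ?y powr (- s))"
    by (simp add: mult_ac)
  also have "?y powr s * ?y powr (- s) = 1" by (simp flip: powr_add)
  finally show ?thesis by simp
qed

subsection \<open>Linear processes and off-diagonal forms\<close>

lemma symmetric_sum_int:
  fixes f :: "int \<Rightarrow> 'b::comm_monoid_add"
  shows "(\<Sum>l\<in>{- int N..int N}. f l) = f 0 + (\<Sum>j<N. f (int j + 1) + f (- int j - 1))"
proof (induction N)
  case (Suc N)
  have "{- int (Suc N)..int (Suc N)} = insert (int N + 1) (insert (- int N - 1) {- int N..int N})" by auto
  with Suc show ?case by (simp add: algebra_simps)
qed simp

lemma summation_by_parts:
  fixes a x :: "nat \<Rightarrow> real"
  shows "(\<Sum>k<n. a k * x k) = a n * (\<Sum>k<n. x k) + (\<Sum>k<n. (a k - a (Suc k)) * (\<Sum>j<Suc k. x j))"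
  by (induction n) (simp_all add: algebra_simps)

text \<open>Abel summation: the boundary term tends to 0 because \<open>r < s\<close>, and the
  weight differences are of order \<open>k powr (- s - 1)\<close>, so that against partial sums of
  order \<open>k powr r\<close> the series converges absolutely.\<close>

lemma convergent_weighted_sum_of_growth:
  fixes x :: "nat \<Rightarrow> real"
  assumes r: "0 < r" "r < s" and lim: "(\<lambda>n. (\<Sum>k<n. x k) / real n powr r) \<longlonglongrightarrow> 0"
  shows "convergent (\<lambda>n. \<Sum>k<n. (real k + 1) powr (- s) * x k)"
proof -
  define U where "U n = (\<Sum>k<n. x k)" for n
  define a where "a k = (real k + 1) powr (- s)" for k
  have U0: "(\<lambda>n. U n / real n powr r) \<longlonglongrightarrow> 0" using lim by (simp add: U_def)
  obtain K where K: "\<And>n. \<bar>U n / real n powr r\<bar> \<le> K"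
    using convergent_imp_Bseq[OF convergentI[OF U0]] unfolding Bseq_def by auto
  have UK: "\<bar>U (Suc n)\<bar> \<le> K * (real n + 1) powr r" for n
    using K[of "Suc n"] by (simp add: abs_divide divide_le_eq add.commute)
  have "(\<lambda>n. a n * real n powr r) \<longlonglongrightarrow> 0"
    unfolding a_def using r by real_asymp
  from tendsto_mult[OF this U0] have "(\<lambda>n. a n * real n powr r * (U n / real n powr r)) \<longlonglongrightarrow> 0" by simp
  \<comment> \<open>At \<open>n = 0\<close> nothing can be cancelled, but both sides vanish since
    \<open>U 0 = 0\<close>.\<close>
  moreover have "a n * real n powr r * (U n / real n powr r) = a n * U n" for n
    by (cases "n = 0") (simp_all add: U_def)
  ultimately have 1: "(\<lambda>n. a n * U n) \<longlonglongrightarrow> 0" by simp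
  have "summable (\<lambda>k. (a k - a (Suc k)) * U (Suc k))"
  proof (rule summable_comparison_test')
    have "summable (\<lambda>k. real k powr (r - s - 1))"
      using r by (simp add: summable_real_powr_iff)
    hence "summable (\<lambda>k. (real k + 1) powr (r - s - 1))"
      by (subst (asm) summable_Suc_iff[symmetric]) (simp add: add.commute)
    thus "summable (\<lambda>k. s * K * (real k + 1) powr (r - s - 1))"
      by (rule summable_mult)
    fix k :: nat
    have "\<exists>z>real k + 1. z < real k + 2 \<and>
        (real k + 2) powr (- s) - (real k + 1) powr (- s) = ((real k + 2) - (real k + 1)) * (- s * z powr (- s - 1))"
    proof (rule MVT2)
      fix x :: real assume "real k + 1 \<le> x"
      thus "((\<lambda>a. a powr - s) has_real_derivative - s * x powr (- s - 1)) (at x)"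
        by (intro has_real_derivative_powr) auto
    qed simp
    then obtain z where z: "real k + 1 < z" "a k - a (Suc k) = s * z powr (- s - 1)"
      by (auto simp: a_def algebra_simps)
    have "s * z powr (- s - 1) \<le> s * (real k + 1) powr (- s - 1)"
      using z r by (intro mult_left_mono powr_mono2') auto
    moreover have "0 \<le> s * z powr (- s - 1)" using r by simp
    moreover have "norm ((a k - a (Suc k)) * U (Suc k)) = (s * z powr (- s - 1)) * \<bar>U (Suc k)\<bar>"
      unfolding z(2) real_norm_def abs_mult[of "s * _"] using calculation by simp
    ultimately have "norm ((a k - a (Suc k)) * U (Suc k)) \<le> (s * (real k + 1) powr (- s - 1)) * (K * (real k + 1) powr r)"
      using r by (auto intro!: mult_mono UK)
    also have "\<dots> = s * K * ((real k + 1) powr (- s - 1) * (real k + 1) powr r)"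
      by (simp add: mult_ac)
    also have "(real k + 1) powr (- s - 1) * (real k + 1) powr r = (real k + 1) powr (r - s - 1)"
      by (simp add: algebra_simps flip: powr_add)
    finally show "norm ((a k - a (Suc k)) * U (Suc k)) \<le> s * K * (real k + 1) powr (r - s - 1)" .
  qed
  hence 2: "convergent (\<lambda>n. \<Sum>k<n. (a k - a (Suc k)) * U (Suc k))"
    by (simp add: summable_iff_convergent)
  have "(\<Sum>k<n. (real k + 1) powr (- s) * x k) = a n * U n + (\<Sum>k<n. (a k - a (Suc k)) * U (Suc k))" for n
    using summation_by_parts[of a x n] by (simp add: a_def U_def)
  with convergent_add[OF convergentI[OF 1] 2] show ?thesis by simp
qed

context prob_space
begin

lemma nn_integral_powr_le:
  assumes "integrable M (\<lambda>\<omega>. \<bar>f \<omega>\<bar> powr q)" "expectation (\<lambda>\<omega>. \<bar>f \<omega>\<bar> powr q) \<le> B"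
  shows "(\<integral>\<^sup>+\<omega>. ennreal (\<bar>f \<omega>\<bar> powr q) \<partial>M) \<le> ennreal B"
  using assms by (simp add: nn_integral_eq_integral ennreal_leI)

text \<open>Deterministic weights are the case of a past factor \<open>h i\<close> that ignores its
  argument.\<close>

lemma moment_weighted_sum:
  fixes X :: "'i::linorder \<Rightarrow> 'a \<Rightarrow> 'b" and g :: "'b \<Rightarrow> real" and b :: "'i \<Rightarrow> real"
  assumes q: "1 < q" "q \<le> 2" and I: "finite I"
    and ind: "indep_vars (\<lambda>_. N) X UNIV" and g: "g \<in> borel_measurable N"
    and gint: "\<And>i. integrable M (\<lambda>\<omega>. \<bar>g (X i \<omega>)\<bar> powr q)"
    and V: "\<And>i. expectation (\<lambda>\<omega>. \<bar>g (X i \<omega>)\<bar> powr q) \<le> V"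
    and mean: "\<And>i. expectation (\<lambda>\<omega>. g (X i \<omega>)) = 0"
  shows "integrable M (\<lambda>\<omega>. \<bar>\<Sum>i\<in>I. g (X i \<omega>) * b i\<bar> powr q)"
    and "expectation (\<lambda>\<omega>. \<bar>\<Sum>i\<in>I. g (X i \<omega>) * b i\<bar> powr q) \<le> 2 * q * V * (\<Sum>i\<in>I. \<bar>b i\<bar> powr q)"
proof -
  note * = moment_martingale_transform[OF q I ind g gint mean, of "\<lambda>i _. b i"]
  show "integrable M (\<lambda>\<omega>. \<bar>\<Sum>i\<in>I. g (X i \<omega>) * b i\<bar> powr q)"
    using * by simp
  have "expectation (\<lambda>\<omega>. \<bar>\<Sum>i\<in>I. g (X i \<omega>) * b i\<bar> powr q)
      \<le> 2 * q * (\<Sum>i\<in>I. expectation (\<lambda>\<omega>. \<bar>g (X i \<omega>)\<bar> powr q) * \<bar>b i\<bar> powr q)"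
    using * by (simp add: prob_space)
  also have "\<dots> \<le> 2 * q * (\<Sum>i\<in>I. V * \<bar>b i\<bar> powr q)"
    using q by (intro mult_left_mono sum_mono mult_right_mono V) auto
  finally show "expectation (\<lambda>\<omega>. \<bar>\<Sum>i\<in>I. g (X i \<omega>) * b i\<bar> powr q) \<le> 2 * q * V * (\<Sum>i\<in>I. \<bar>b i\<bar> powr q)"
    by (simp add: sum_distrib_left mult.assoc)
qed

text \<open>The inner sum over \<open>l < m\<close> is the past factor of \<open>g (X m)\<close>.
  The moment inequality at exponent 2 costs a factor 4 and is applied twice, to the inner sums and
  to the outer transform; hence 16. As \<open>l < m\<close> is strict, \<open>u\<close> and
  \<open>g\<close> are never evaluated at the same variable within one product.\<close>

lemma second_moment_triangular_form:
  fixes X :: "'i::linorder \<Rightarrow> 'a \<Rightarrow> 'b" and u g :: "'b \<Rightarrow> real" and w :: "'i \<Rightarrow> 'i \<Rightarrow> real"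
  assumes I: "finite I" and ind: "indep_vars (\<lambda>_. N) X UNIV"
    and u[measurable]: "u \<in> borel_measurable N" and g: "g \<in> borel_measurable N"
    and uint: "\<And>i. integrable M (\<lambda>\<omega>. \<bar>u (X i \<omega>)\<bar> powr 2)"
    and U: "\<And>i. expectation (\<lambda>\<omega>. \<bar>u (X i \<omega>)\<bar> powr 2) \<le> U"
    and umean: "\<And>i. expectation (\<lambda>\<omega>. u (X i \<omega>)) = 0"
    and gint: "\<And>i. integrable M (\<lambda>\<omega>. \<bar>g (X i \<omega>)\<bar> powr 2)"
    and V: "\<And>i. expectation (\<lambda>\<omega>. \<bar>g (X i \<omega>)\<bar> powr 2) \<le> V"
    and gmean: "\<And>i. expectation (\<lambda>\<omega>. g (X i \<omega>)) = 0"
  shows "(\<integral>\<^sup>+\<omega>. ennreal (\<bar>\<Sum>m\<in>I. g (X m \<omega>) * (\<Sum>l\<in>{l\<in>I. l < m}. u (X l \<omega>) * w l m)\<bar> powr 2) \<partial>M)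
    \<le> ennreal (16 * U * V * (\<Sum>l\<in>I. \<Sum>m\<in>I. (w l m)\<^sup>2))"
proof -
  define h where "h m z = (\<Sum>l\<in>{l\<in>I. l < m}. u (z l) * w l m)" for m :: 'i and z :: "'i \<Rightarrow> 'b"
  have h: "h m (\<lambda>j\<in>{..<m}. X j \<omega>) = (\<Sum>l\<in>{l\<in>I. l < m}. u (X l \<omega>) * w l m)" for m \<omega>
    unfolding h_def by (intro sum.cong) auto
  have hm: "h m \<in> borel_measurable (PiM {..<m} (\<lambda>_. N))" for m
    unfolding h_def
    by (intro borel_measurable_sum borel_measurable_times measurable_compose[OF _ u] measurable_component_singleton) auto
  \<comment> \<open>\<open>undefined\<close> merely serves as some index of the type.\<close>
  have U0: "0 \<le> U" and V0: "0 \<le> V"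
    by (rule order_trans[OF Bochner_Integration.integral_nonneg U[of undefined]], simp)
      (rule order_trans[OF Bochner_Integration.integral_nonneg V[of undefined]], simp)
  have fin: "finite {l\<in>I. l < m}" for m using I by simp
  note Y = moment_weighted_sum[where q = 2, OF _ _ fin ind u uint U umean]
  have Yint: "integrable M (\<lambda>\<omega>. \<bar>h m (\<lambda>j\<in>{..<m}. X j \<omega>)\<bar> powr 2)" for m
    unfolding h using Y(1) by simp
  have YE: "expectation (\<lambda>\<omega>. \<bar>h m (\<lambda>j\<in>{..<m}. X j \<omega>)\<bar> powr 2) \<le> 4 * U * (\<Sum>l\<in>I. (w l m)\<^sup>2)" for m
  proof -
    have "expectation (\<lambda>\<omega>. \<bar>h m (\<lambda>j\<in>{..<m}. X j \<omega>)\<bar> powr 2) \<le> 4 * U * (\<Sum>l\<in>{l\<in>I. l < m}. (w l m)\<^sup>2)"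
      unfolding h by (rule order_trans[OF Y(2)]) simp_all
    also have "\<dots> \<le> 4 * U * (\<Sum>l\<in>I. (w l m)\<^sup>2)"
      using I U0 by (intro mult_left_mono sum_mono2) auto
    finally show ?thesis .
  qed
  note T = moment_martingale_transform[where q = 2, OF _ _ I ind g gint gmean hm Yint]
  have "expectation (\<lambda>\<omega>. \<bar>\<Sum>m\<in>I. g (X m \<omega>) * h m (\<lambda>j\<in>{..<m}. X j \<omega>)\<bar> powr 2)
      \<le> 2 * 2 * (\<Sum>m\<in>I. expectation (\<lambda>\<omega>. \<bar>g (X m \<omega>)\<bar> powr 2) * expectation (\<lambda>\<omega>. \<bar>h m (\<lambda>j\<in>{..<m}. X j \<omega>)\<bar> powr 2))"
    by (rule conjunct2[OF T]) simp_all
  also have "\<dots> \<le> 2 * 2 * (\<Sum>m\<in>I. V * (4 * U * (\<Sum>l\<in>I. (w l m)\<^sup>2)))"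
    using V0 by (intro mult_left_mono sum_mono mult_mono V YE) (auto intro!: integral_nonneg)
  also have "\<dots> = 16 * U * V * (\<Sum>l\<in>I. \<Sum>m\<in>I. (w l m)\<^sup>2)"
    by (subst sum.swap) (simp add: sum_distrib_left mult_ac)
  finally have E: "expectation (\<lambda>\<omega>. \<bar>\<Sum>m\<in>I. g (X m \<omega>) * h m (\<lambda>j\<in>{..<m}. X j \<omega>)\<bar> powr 2)
      \<le> 16 * U * V * (\<Sum>l\<in>I. \<Sum>m\<in>I. (w l m)\<^sup>2)" .
  have "integrable M (\<lambda>\<omega>. \<bar>\<Sum>m\<in>I. g (X m \<omega>) * h m (\<lambda>j\<in>{..<m}. X j \<omega>)\<bar> powr 2)"
    by (rule conjunct1[OF T]) simp_all
  from nn_integral_powr_le[OF this E] show ?thesis unfolding h .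
qed

text \<open>The pairs \<open>l < m\<close> and \<open>m < l\<close> give two triangular forms with
  the roles of \<open>u\<close> and \<open>g\<close> exchanged. Squaring their sum doubles each
  bound, so 64 is \<open>2 * 16 + 2 * 16\<close>.\<close>

lemma second_moment_offdiagonal_form:
  fixes X :: "'i::linorder \<Rightarrow> 'a \<Rightarrow> 'b" and u g :: "'b \<Rightarrow> real" and w :: "'i \<Rightarrow> 'i \<Rightarrow> real"
  assumes I: "finite I" and ind: "indep_vars (\<lambda>_. N) X UNIV"
    and u: "u \<in> borel_measurable N" and g: "g \<in> borel_measurable N"
    and uint: "\<And>i. integrable M (\<lambda>\<omega>. \<bar>u (X i \<omega>)\<bar> powr 2)"
    and U: "\<And>i. expectation (\<lambda>\<omega>. \<bar>u (X i \<omega>)\<bar> powr 2) \<le> U"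
    and umean: "\<And>i. expectation (\<lambda>\<omega>. u (X i \<omega>)) = 0"
    and gint: "\<And>i. integrable M (\<lambda>\<omega>. \<bar>g (X i \<omega>)\<bar> powr 2)"
    and V: "\<And>i. expectation (\<lambda>\<omega>. \<bar>g (X i \<omega>)\<bar> powr 2) \<le> V"
    and gmean: "\<And>i. expectation (\<lambda>\<omega>. g (X i \<omega>)) = 0"
  shows "(\<integral>\<^sup>+\<omega>. ennreal (\<bar>\<Sum>l\<in>I. \<Sum>m\<in>I - {l}. w l m * u (X l \<omega>) * g (X m \<omega>)\<bar> powr 2) \<partial>M)
    \<le> ennreal (64 * U * V * (\<Sum>l\<in>I. \<Sum>m\<in>I. (w l m)\<^sup>2))"
proof -
  define S1 where "S1 \<omega> = (\<Sum>m\<in>I. g (X m \<omega>) * (\<Sum>l\<in>{l\<in>I. l < m}. u (X l \<omega>) * w l m))" for \<omega>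
  define S2 where "S2 \<omega> = (\<Sum>l\<in>I. u (X l \<omega>) * (\<Sum>m\<in>{m\<in>I. m < l}. g (X m \<omega>) * w l m))" for \<omega>
  define D where "D = (\<Sum>l\<in>I. \<Sum>m\<in>I. (w l m)\<^sup>2)"
  have Xm: "X i \<in> measurable M N" for i using ind by (auto simp: indep_vars_def)
  have [measurable]: "(\<lambda>\<omega>. u (X i \<omega>)) \<in> borel_measurable M" "(\<lambda>\<omega>. g (X i \<omega>)) \<in> borel_measurable M" for i
    using measurable_compose[OF Xm u] measurable_compose[OF Xm g] by auto
  have [measurable]: "S1 \<in> borel_measurable M" "S2 \<in> borel_measurable M"
    unfolding S1_def S2_def by measurable
  have U0: "0 \<le> U" and V0: "0 \<le> V"
    by (rule order_trans[OF Bochner_Integration.integral_nonneg U[of undefined]], simp)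
      (rule order_trans[OF Bochner_Integration.integral_nonneg V[of undefined]], simp)
  have D0: "0 \<le> D" unfolding D_def by (intro sum_nonneg) auto
  have split: "(\<Sum>l\<in>I. \<Sum>m\<in>I - {l}. w l m * u (X l \<omega>) * g (X m \<omega>)) = S1 \<omega> + S2 \<omega>" for \<omega>
  proof -
    let ?t = "\<lambda>l m. w l m * u (X l \<omega>) * g (X m \<omega>)"
    have "(\<Sum>m\<in>I - {l}. ?t l m) = (\<Sum>m\<in>{m\<in>I. l < m}. ?t l m) + (\<Sum>m\<in>{m\<in>I. m < l}. ?t l m)" for l
      using I by (subst sum.union_disjoint[symmetric]) (auto intro!: sum.cong)
    hence "(\<Sum>l\<in>I. \<Sum>m\<in>I - {l}. ?t l m)
        = (\<Sum>l\<in>I. \<Sum>m\<in>{m\<in>I. l < m}. ?t l m) + (\<Sum>l\<in>I. \<Sum>m\<in>{m\<in>I. m < l}. ?t l m)"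
      by (simp add: sum.distrib)
    also have "(\<Sum>l\<in>I. \<Sum>m\<in>{m\<in>I. l < m}. ?t l m) = (\<Sum>m\<in>I. \<Sum>l\<in>{l\<in>I. l < m}. ?t l m)"
      using I by (rule sum.swap_restrict) (rule I)
    also have "\<dots> = S1 \<omega>" unfolding S1_def by (simp add: sum_distrib_left mult_ac)
    also have "(\<Sum>l\<in>I. \<Sum>m\<in>{m\<in>I. m < l}. ?t l m) = S2 \<omega>"
      unfolding S2_def by (simp add: sum_distrib_left mult_ac)
    finally show ?thesis .
  qed
  have 1: "(\<integral>\<^sup>+\<omega>. ennreal (\<bar>S1 \<omega>\<bar> powr 2) \<partial>M) \<le> ennreal (16 * U * V * D)"
    unfolding S1_def D_def by (rule second_moment_triangular_form[OF I ind u g uint U umean gint V gmean])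
  have "(\<integral>\<^sup>+\<omega>. ennreal (\<bar>S2 \<omega>\<bar> powr 2) \<partial>M) \<le> ennreal (16 * V * U * (\<Sum>m\<in>I. \<Sum>l\<in>I. (w l m)\<^sup>2))"
    unfolding S2_def
    by (rule second_moment_triangular_form[OF I ind g u gint V gmean uint U umean, where w = "\<lambda>m l. w l m"])
  hence 2: "(\<integral>\<^sup>+\<omega>. ennreal (\<bar>S2 \<omega>\<bar> powr 2) \<partial>M) \<le> ennreal (16 * U * V * D)"
    unfolding D_def by (subst sum.swap) (simp add: mult_ac)
  have "(\<integral>\<^sup>+\<omega>. ennreal (\<bar>S1 \<omega> + S2 \<omega>\<bar> powr 2) \<partial>M)
      \<le> (\<integral>\<^sup>+\<omega>. 2 * ennreal (\<bar>S1 \<omega>\<bar> powr 2) + 2 * ennreal (\<bar>S2 \<omega>\<bar> powr 2) \<partial>M)"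
  proof (rule nn_integral_mono)
    fix \<omega>
    have "\<bar>S1 \<omega> + S2 \<omega>\<bar> powr 2 \<le> 2 * \<bar>S1 \<omega>\<bar> powr 2 + 2 * \<bar>S2 \<omega>\<bar> powr 2"
      using sum_squares_bound[of "S1 \<omega>" "S2 \<omega>"] by (simp add: power2_sum)
    hence "ennreal (\<bar>S1 \<omega> + S2 \<omega>\<bar> powr 2) \<le> ennreal (2 * \<bar>S1 \<omega>\<bar> powr 2 + 2 * \<bar>S2 \<omega>\<bar> powr 2)"
      by (rule ennreal_leI)
    also have "\<dots> = 2 * ennreal (\<bar>S1 \<omega>\<bar> powr 2) + 2 * ennreal (\<bar>S2 \<omega>\<bar> powr 2)"
      by (simp add: ennreal_mult)
    finally show "ennreal (\<bar>S1 \<omega> + S2 \<omega>\<bar> powr 2) \<le> 2 * ennreal (\<bar>S1 \<omega>\<bar> powr 2) + 2 * ennreal (\<bar>S2 \<omega>\<bar> powr 2)" .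
  qed
  also have "\<dots> = 2 * (\<integral>\<^sup>+\<omega>. ennreal (\<bar>S1 \<omega>\<bar> powr 2) \<partial>M) + 2 * (\<integral>\<^sup>+\<omega>. ennreal (\<bar>S2 \<omega>\<bar> powr 2) \<partial>M)"
    by (simp add: nn_integral_add nn_integral_cmult)
  also have "\<dots> \<le> 2 * ennreal (16 * U * V * D) + 2 * ennreal (16 * U * V * D)"
    by (intro add_mono mult_left_mono 1 2) auto
  also have "\<dots> = ennreal (2 * (16 * U * V * D) + 2 * (16 * U * V * D))"
  proof -
    have "2 * ennreal x + 2 * ennreal x = ennreal (2 * x + 2 * x)" if "0 \<le> x" for x
    proof -
      have "2 * ennreal x = ennreal (2 * x)" using that by (simp add: ennreal_mult)
      thus ?thesis using that by (subst ennreal_plus) simp_all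
    qed
    thus ?thesis using U0 V0 D0 by simp
  qed
  also have "2 * (16 * U * V * D) + 2 * (16 * U * V * D) = 64 * U * V * D" by simp
  finally show ?thesis unfolding split D_def .
qed

text \<open>A case of Kolmogorov's two-series theorem, from the strong law for the rescaled
  summands \<open>\<bar>l\<bar> powr s * b l * g (X l)\<close> and summation by parts.\<close>
lemma AE_convergent_linear_process:
  fixes X :: "int \<Rightarrow> 'a \<Rightarrow> 'b" and g :: "'b \<Rightarrow> real" and b :: "int \<Rightarrow> real"
  assumes ind: "indep_vars (\<lambda>_. N) X UNIV" and g: "g \<in> borel_measurable N"
    and gint: "\<And>i. integrable M (\<lambda>\<omega>. \<bar>g (X i \<omega>)\<bar> powr 2)"
    and V: "\<And>i. expectation (\<lambda>\<omega>. \<bar>g (X i \<omega>)\<bar> powr 2) \<le> V"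
    and mean: "\<And>i. expectation (\<lambda>\<omega>. g (X i \<omega>)) = 0"
    and s: "1/2 < s" and A: "\<And>l. \<bar>real_of_int l\<bar> powr s * \<bar>b l\<bar> \<le> A"
  shows "AE \<omega> in M. convergent (\<lambda>n. \<Sum>l\<in>{- int n..int n}. b l * g (X l \<omega>))"
proof -
  define \<beta> where "\<beta> l = \<bar>real_of_int l\<bar> powr s * b l" for l
  define x where "x k \<omega> = \<beta> (int k + 1) * g (X (int k + 1) \<omega>) + \<beta> (- int k - 1) * g (X (- int k - 1) \<omega>)" for k \<omega>
  \<comment> \<open>Then \<open>1 / p\<close> is the midpoint of \<open>1 / 2\<close> and
    \<open>s\<close>: above \<open>1 / 2\<close> as the strong law demands, below \<open>s\<close>
    as Abel summation demands.\<close>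
  define p where "p = 2 / (s + 1/2)"
  have Xm: "X i \<in> measurable M N" for i using ind by (auto simp: indep_vars_def)
  have [measurable]: "(\<lambda>\<omega>. g (X i \<omega>)) \<in> borel_measurable M" for i
    using measurable_compose[OF Xm g] by auto
  have V0: "0 \<le> V" by (rule order_trans[OF Bochner_Integration.integral_nonneg V[of undefined]]) simp
  have "AE \<omega> in M. (\<lambda>n. (\<Sum>k<n. x k \<omega>) / real n powr (1 / p)) \<longlonglongrightarrow> 0"
  proof (rule strong_law_of_block_moments[where q = 2 and \<gamma> = 1 and C = "8 * V * A\<^sup>2"])
    show "x k \<in> borel_measurable M" for k unfolding x_def by measurable
    show "0 < p" "1 / 2 < 1 / p" using s by (auto simp: p_def)
    show "0 \<le> 8 * V * A\<^sup>2" using V0 by simp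
    fix m n :: nat
    \<comment> \<open>The indices \<open>k + 1\<close> and \<open>- k - 1\<close> of a block are
      \<open>2 * n\<close> distinct integers, so the block sum is a single linear form. Its squared
      weights are at most \<open>A\<^sup>2\<close>, which with the factor 4 of the moment bound
      gives the constant \<open>8 * V * A\<^sup>2\<close>.\<close>
    define J1 where "J1 = (\<lambda>k. int k + 1) ` {m..<m+n}"
    define J2 where "J2 = (\<lambda>k. - int k - 1) ` {m..<m+n}"
    have J: "finite J1" "finite J2" "J1 \<inter> J2 = {}" "card J1 = n" "card J2 = n"
      unfolding J1_def J2_def by (auto simp: card_image inj_on_def)
    have eq: "(\<Sum>k\<in>{m..<m+n}. x k \<omega>) = (\<Sum>l\<in>J1 \<union> J2. g (X l \<omega>) * \<beta> l)" for \<omega>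
    proof -
      have "(\<Sum>l\<in>J1 \<union> J2. g (X l \<omega>) * \<beta> l) = (\<Sum>l\<in>J1. g (X l \<omega>) * \<beta> l) + (\<Sum>l\<in>J2. g (X l \<omega>) * \<beta> l)"
        using J by (intro sum.union_disjoint)
      also have "\<dots> = (\<Sum>k\<in>{m..<m+n}. x k \<omega>)"
        unfolding J1_def J2_def x_def sum.distrib
        by (subst (1 2) sum.reindex) (auto simp: inj_on_def mult.commute)
      finally show ?thesis by simp
    qed
    have "(\<Sum>l\<in>J1 \<union> J2. \<bar>\<beta> l\<bar> powr 2) \<le> (\<Sum>l\<in>J1 \<union> J2. A\<^sup>2)"
      using A by (intro sum_mono) (auto simp: \<beta>_def abs_mult power_mono)
    also have "\<dots> = 2 * real n * A\<^sup>2"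
      using J by (simp add: card_Un_disjoint)
    finally have "4 * V * (\<Sum>l\<in>J1 \<union> J2. \<bar>\<beta> l\<bar> powr 2) \<le> 4 * V * (2 * real n * A\<^sup>2)"
      using V0 by (intro mult_left_mono) auto
    hence B: "2 * 2 * V * (\<Sum>l\<in>J1 \<union> J2. \<bar>\<beta> l\<bar> powr 2) \<le> 8 * V * A\<^sup>2 * real n powr 1"
      by (simp add: mult_ac)
    have fin: "finite (J1 \<union> J2)" using J by simp
    note W = moment_weighted_sum[where q = 2, OF _ _ fin ind g gint V mean, where b = \<beta>]
    show "(\<integral>\<^sup>+\<omega>. ennreal (\<bar>\<Sum>k\<in>{m..<m+n}. x k \<omega>\<bar> powr 2) \<partial>M) \<le> ennreal (8 * V * A\<^sup>2 * real n powr 1)"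
      unfolding eq
      by (rule nn_integral_powr_le[OF W(1) order_trans[OF W(2) B]]) simp_all
  qed auto
  thus ?thesis
  proof eventually_elim
    case (elim \<omega>)
    have "convergent (\<lambda>n. \<Sum>k<n. (real k + 1) powr (- s) * x k \<omega>)"
      using s by (intro convergent_weighted_sum_of_growth[OF _ _ elim]) (auto simp: p_def)
    hence "convergent (\<lambda>n. b 0 * g (X 0 \<omega>) + (\<Sum>k<n. (real k + 1) powr (- s) * x k \<omega>))"
      by (intro convergent_add convergent_const)
    moreover have "(real k + 1) powr (- s) * x k \<omega>
        = b (int k + 1) * g (X (int k + 1) \<omega>) + b (- int k - 1) * g (X (- int k - 1) \<omega>)" for k
    proof -
      have "\<bar>- real k - 1\<bar> = real k + 1" "\<bar>real k + 1\<bar> = real k + 1" by auto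
      thus ?thesis by (simp add: x_def \<beta>_def powr_minus field_simps)
    qed
    ultimately show ?case by (simp add: symmetric_sum_int)
  qed
qed

text \<open>First moments and absolutely summable weights suffice, without independence. This suits
  the diagonal products, whose second moments may be infinite.\<close>

lemma AE_convergent_absolutely_weighted_sum:
  fixes Z :: "int \<Rightarrow> 'a \<Rightarrow> real" and a :: "int \<Rightarrow> real"
  assumes Z: "\<And>l. integrable M (Z l)" "\<And>l. expectation (\<lambda>\<omega>. \<bar>Z l \<omega>\<bar>) \<le> V"
    and a: "\<And>I. finite I \<Longrightarrow> (\<Sum>l\<in>I. \<bar>a l\<bar>) \<le> K"
  shows "AE \<omega> in M. convergent (\<lambda>n. \<Sum>l\<in>{- int n..int n}. a l * Z l \<omega>)"
proof -
  have [measurable]: "Z l \<in> borel_measurable M" for l using Z(1) by auto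
  define v where "v j \<omega> = \<bar>a (int j + 1)\<bar> * \<bar>Z (int j + 1) \<omega>\<bar> + \<bar>a (- int j - 1)\<bar> * \<bar>Z (- int j - 1) \<omega>\<bar>" for j \<omega>
  have V0: "0 \<le> V" by (rule order_trans[OF Bochner_Integration.integral_nonneg Z(2)[of undefined]]) simp
  have "AE \<omega> in M. summable (\<lambda>j. v j \<omega>)"
  proof (rule AE_summable_of_nn_integral)
    show "v j \<in> borel_measurable M" for j unfolding v_def by measurable
    show "0 \<le> v j \<omega>" for j \<omega> unfolding v_def by simp
    show "0 \<le> V * (\<bar>a (int j + 1)\<bar> + \<bar>a (- int j - 1)\<bar>)" for j using V0 by simp
    show "summable (\<lambda>j. V * (\<bar>a (int j + 1)\<bar> + \<bar>a (- int j - 1)\<bar>))"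
    proof (intro summable_mult summableI_nonneg_bounded)
      show "(\<Sum>j<n. \<bar>a (int j + 1)\<bar> + \<bar>a (- int j - 1)\<bar>) \<le> K" for n
        using a[of "{- int n..int n}"] symmetric_sum_int[of "\<lambda>l. \<bar>a l\<bar>" n]
        by (smt (verit) abs_ge_zero finite_atLeastAtMost_int)
    qed simp
    fix j
    have int_v: "integrable M (v j)" unfolding v_def[abs_def] using Z(1) by auto
    have "(\<integral>\<^sup>+\<omega>. ennreal (v j \<omega>) \<partial>M) = ennreal (expectation (v j))"
      by (intro nn_integral_eq_integral int_v) (simp add: v_def)
    also have "expectation (v j) = \<bar>a (int j + 1)\<bar> * expectation (\<lambda>\<omega>. \<bar>Z (int j + 1) \<omega>\<bar>)
        + \<bar>a (- int j - 1)\<bar> * expectation (\<lambda>\<omega>. \<bar>Z (- int j - 1) \<omega>\<bar>)"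
      unfolding v_def using Z(1) by simp
    also have "\<dots> \<le> \<bar>a (int j + 1)\<bar> * V + \<bar>a (- int j - 1)\<bar> * V"
      by (intro add_mono mult_left_mono Z(2)) auto
    also have "\<dots> = V * (\<bar>a (int j + 1)\<bar> + \<bar>a (- int j - 1)\<bar>)" by (simp add: algebra_simps)
    finally show "(\<integral>\<^sup>+\<omega>. ennreal (v j \<omega>) \<partial>M) \<le> ennreal (V * (\<bar>a (int j + 1)\<bar> + \<bar>a (- int j - 1)\<bar>))"
      by (simp add: ennreal_leI)
  qed
  thus ?thesis
  proof eventually_elim
    case (elim \<omega>)
    have "summable (\<lambda>j. a (int j + 1) * Z (int j + 1) \<omega> + a (- int j - 1) * Z (- int j - 1) \<omega>)"
      by (rule summable_comparison_test'[OF elim])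
        (auto simp: v_def abs_mult intro!: order_trans[OF abs_triangle_ineq])
    thus ?case unfolding symmetric_sum_int
      by (intro convergent_add convergent_const) (simp add: summable_iff_convergent)
  qed
qed

end

subsection \<open>The strong law for products\<close>

theorem theorem3:
  fixes M :: "'a measure"
    and \<xi> \<xi>bar :: "int \<Rightarrow> 'a \<Rightarrow> real"
    and c cbar :: "int \<Rightarrow> real"
    and \<alpha> \<sigma> \<sigma>bar p :: real
  assumes "prob_space M"
    and indep: "prob_space.indep_vars M (\<lambda>_. borel :: (real \<times> real) measure)
                  (\<lambda>l \<omega>. (\<xi> l \<omega>, \<xi>bar l \<omega>)) UNIV"
    and ident: "\<And>l. distr M borel (\<lambda>\<omega>. (\<xi> l \<omega>, \<xi>bar l \<omega>)) = distr M borel (\<lambda>\<omega>. (\<xi> 1 \<omega>, \<xi>bar 1 \<omega>))"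
    and int1: "integrable M (\<xi> 1)" and mean1: "integral\<^sup>L M (\<xi> 1) = 0"
    and int2: "integrable M (\<xi>bar 1)" and mean2: "integral\<^sup>L M (\<xi>bar 1) = 0"
    and sq1: "integrable M (\<lambda>\<omega>. (\<xi> 1 \<omega>)\<^sup>2)"
    and sq2: "integrable M (\<lambda>\<omega>. (\<xi>bar 1 \<omega>)\<^sup>2)"
    and alpha: "\<alpha> > 1"
    and tail: "\<exists>C. \<forall>t\<ge>0. t powr \<alpha> * measure M {\<omega> \<in> space M. \<bar>\<xi> 1 \<omega> * \<xi>bar 1 \<omega>\<bar> > t} \<le> C"
    and sigma: "1/2 < \<sigma>" "\<sigma> \<le> 1" and sigmabar: "1/2 < \<sigma>bar" "\<sigma>bar \<le> 1"
    and cdec: "\<exists>C. \<forall>l. \<bar>real_of_int l\<bar> powr \<sigma> * \<bar>c l\<bar> \<le> C"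
    and cbardec: "\<exists>C. \<forall>l. \<bar>real_of_int l\<bar> powr \<sigma>bar * \<bar>cbar l\<bar> \<le> C"
    and p_pos: "0 < p"
    and p_sig: "\<sigma> + \<sigma>bar < 2 \<Longrightarrow> p < 1 / (2 - \<sigma> - \<sigma>bar)"
    and p_alpha: "p < \<alpha>" and p_two: "p < 2"
  shows "AE \<omega> in M.
     (\<lambda>n::nat. (\<Sum>k\<in>{1..int n}.
          dseq c cbar \<xi> \<xi>bar k \<omega>
          - integral\<^sup>L M (\<lambda>\<omega>. \<xi> 1 \<omega> * \<xi>bar 1 \<omega>) * infsum (\<lambda>l. c l * cbar l) UNIV)
        / real n powr (1 / p)) \<longlonglongrightarrow> 0"
proof -

  \<comment> \<open>The common law of the pairs and its moments\<close>
  interpret prob_space M by fact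
  \<comment> \<open>The pair is kept as one variable because its components may be dependent;
    \<open>fst\<close>, \<open>snd\<close> and \<open>z\<close> below are all functions of this one
    independent sequence.\<close>
  define X where "X l \<omega> = (\<xi> l \<omega>, \<xi>bar l \<omega>)" for l \<omega>
  have ind: "indep_vars (\<lambda>_. borel) X UNIV" using indep by (simp add: X_def[abs_def])
  hence Xm: "X l \<in> measurable M borel" for l by (auto simp: indep_vars_def)
  have fm: "fst \<in> borel_measurable (borel :: (real \<times> real) measure)"
    and sm: "snd \<in> borel_measurable (borel :: (real \<times> real) measure)"
    unfolding borel_prod[symmetric] by measurable
  have [measurable]: "\<xi> l \<in> borel_measurable M" "\<xi>bar l \<in> borel_measurable M" for l
    using measurable_compose[OF Xm fm] measurable_compose[OF Xm sm] by (simp_all add: X_def)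
  have same_law: "integrable M (\<lambda>\<omega>. f (X l \<omega>)) \<longleftrightarrow> integrable M (\<lambda>\<omega>. f (X 1 \<omega>))"
    "expectation (\<lambda>\<omega>. f (X l \<omega>)) = expectation (\<lambda>\<omega>. f (X 1 \<omega>))"
    if f: "f \<in> borel_measurable borel" for f :: "real \<times> real \<Rightarrow> real" and l
  proof -
    have D: "distr M borel (X l) = distr M borel (X 1)"
      using ident[of l] by (simp add: X_def[abs_def])
    show "integrable M (\<lambda>\<omega>. f (X l \<omega>)) \<longleftrightarrow> integrable M (\<lambda>\<omega>. f (X 1 \<omega>))"
      using integrable_distr_eq[OF Xm f] D by metis
    show "expectation (\<lambda>\<omega>. f (X l \<omega>)) = expectation (\<lambda>\<omega>. f (X 1 \<omega>))"
      using integral_distr[OF Xm f] D by metis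
  qed
  have powr_meas: "(\<lambda>x. \<bar>f x\<bar> powr r) \<in> borel_measurable borel"
    if "f \<in> borel_measurable borel" for f :: "real \<times> real \<Rightarrow> real" and r
    using that by measurable
  have u_mom: "integrable M (\<lambda>\<omega>. \<bar>fst (X l \<omega>)\<bar> powr 2)"
    "expectation (\<lambda>\<omega>. \<bar>fst (X l \<omega>)\<bar> powr 2) \<le> expectation (\<lambda>\<omega>. (\<xi> 1 \<omega>)\<^sup>2)"
    "expectation (\<lambda>\<omega>. fst (X l \<omega>)) = 0" for l
    using sq1 mean1 same_law[OF powr_meas[OF fm], of l 2] same_law(2)[OF fm, of l] by (simp_all add: X_def)
  have v_mom: "integrable M (\<lambda>\<omega>. \<bar>snd (X l \<omega>)\<bar> powr 2)"
    "expectation (\<lambda>\<omega>. \<bar>snd (X l \<omega>)\<bar> powr 2) \<le> expectation (\<lambda>\<omega>. (\<xi>bar 1 \<omega>)\<^sup>2)"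
    "expectation (\<lambda>\<omega>. snd (X l \<omega>)) = 0" for l
    using sq2 mean2 same_law[OF powr_meas[OF sm], of l 2] same_law(2)[OF sm, of l] by (simp_all add: X_def)
  define U where "U = expectation (\<lambda>\<omega>. (\<xi> 1 \<omega>)\<^sup>2)"
  define V where "V = expectation (\<lambda>\<omega>. (\<xi>bar 1 \<omega>)\<^sup>2)"
  have UV0: "0 \<le> U" "0 \<le> V" unfolding U_def V_def by simp_all

  \<comment> \<open>\<open>q > 1\<close> and \<open>q < 2\<close> are for the von Bahr--Esseen
    inequality, \<open>q < \<alpha>\<close> for the moment of the product, \<open>p < q\<close> for
    the rate. Since \<open>p\<close> may be below 1, the lower end is
    \<open>max p 1\<close>.\<close>
  obtain q where q: "p < q" "1 < q" "q < \<alpha>" "q < 2"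
    using dense[of "max p 1" "min \<alpha> 2"] p_alpha p_two alpha by auto
  define \<mu> where "\<mu> = expectation (\<lambda>\<omega>. \<xi> 1 \<omega> * \<xi>bar 1 \<omega>)"
  define z where "z = (\<lambda>x :: real \<times> real. fst x * snd x - \<mu>)"
  have zm: "z \<in> borel_measurable borel"
    unfolding z_def using fm sm by measurable
  obtain C where "\<forall>t\<ge>0. t powr \<alpha> * prob {\<omega> \<in> space M. \<bar>\<xi> 1 \<omega> * \<xi>bar 1 \<omega>\<bar> > t} \<le> C"
    using tail by blast
  hence prod_q: "integrable M (\<lambda>\<omega>. \<bar>\<xi> 1 \<omega> * \<xi>bar 1 \<omega>\<bar> powr q)"
    using q by (intro integrable_powr_of_tail[where \<alpha> = \<alpha> and C = C]) auto
  have prod_int: "integrable M (\<lambda>\<omega>. \<xi> 1 \<omega> * \<xi>bar 1 \<omega>)"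
    using q by (intro integrable_of_integrable_powr[OF _ _ prod_q]) auto
  have "integrable M (\<lambda>\<omega>. \<bar>\<xi> 1 \<omega> * \<xi>bar 1 \<omega> + - \<mu>\<bar> powr q)"
    using q by (intro integrable_powr_add prod_q) auto
  hence z_q: "integrable M (\<lambda>\<omega>. \<bar>z (X l \<omega>)\<bar> powr q)" for l
    using same_law(1)[OF powr_meas[OF zm], of l q] by (simp add: z_def X_def)
  have z_int: "integrable M (\<lambda>\<omega>. z (X l \<omega>))" for l
    using same_law(1)[OF zm, of l] prod_int by (simp add: z_def X_def)
  have z_mean: "expectation (\<lambda>\<omega>. z (X l \<omega>)) = 0" for l
    using same_law(2)[OF zm, of l] prod_int by (simp add: z_def X_def \<mu>_def prob_space)
  define Vq where "Vq = expectation (\<lambda>\<omega>. \<bar>z (X 1 \<omega>)\<bar> powr q)"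
  have Vq: "expectation (\<lambda>\<omega>. \<bar>z (X l \<omega>)\<bar> powr q) \<le> Vq" for l
    unfolding Vq_def using same_law(2)[OF powr_meas[OF zm], of l q] by simp
  have Vq0: "0 \<le> Vq" unfolding Vq_def by simp

  \<comment> \<open>Decay of the weights\<close>
  obtain A where A: "0 \<le> A" "\<And>l. \<bar>c l\<bar> \<le> A * (1 + \<bar>real_of_int l\<bar>) powr (- \<sigma>)"
    using decay_bound[OF cdec] sigma by auto
  obtain A' where A': "0 \<le> A'" "\<And>l. \<bar>cbar l\<bar> \<le> A' * (1 + \<bar>real_of_int l\<bar>) powr (- \<sigma>bar)"
    using decay_bound[OF cbardec] sigmabar by auto
  define a where "a l = c l * cbar l" for l
  have a: "\<bar>a l\<bar> \<le> (A * A') * (1 + \<bar>real_of_int l\<bar>) powr (- (\<sigma> + \<sigma>bar))" for l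
  proof -
    have "\<bar>a l\<bar> \<le> (A * (1 + \<bar>real_of_int l\<bar>) powr (- \<sigma>)) * (A' * (1 + \<bar>real_of_int l\<bar>) powr (- \<sigma>bar))"
      unfolding a_def abs_mult by (intro mult_mono A(2) A'(2)) (use A(1) in auto)
    also have "\<dots> = (A * A') * ((1 + \<bar>real_of_int l\<bar>) powr (- \<sigma>) * (1 + \<bar>real_of_int l\<bar>) powr (- \<sigma>bar))"
      by (simp add: mult_ac)
    finally show ?thesis by (simp flip: powr_add)
  qed
  have sig1: "1 < \<sigma> + \<sigma>bar" using sigma sigmabar by simp
  have AA: "0 \<le> A * A'" using A A' by simp
  obtain K where K: "0 \<le> K" "\<And>k I. finite I \<Longrightarrow> (\<Sum>l\<in>I. \<bar>a (k - l)\<bar>) \<le> K"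
    "\<And>l I. finite I \<Longrightarrow> (\<Sum>k\<in>I. \<bar>a (k - l)\<bar>) \<le> K"
    using sum_abs_shift_bound[OF sig1 AA a] by metis

  \<comment> \<open>Truncation and splitting\<close>
  define I where "I n = {- int n..int n}" for n
  have finI: "finite (I n)" for n by (simp add: I_def)
  \<comment> \<open>\<open>F1\<close> is the off-diagonal part and \<open>F2\<close> the centred
    diagonal; centring leaves the deterministic term \<open>\<mu> * s n k\<close>, which tends to
    \<open>\<mu> * d\<close> for every \<open>k\<close>.\<close>
  define F1 where "F1 n k \<omega> = (\<Sum>l\<in>I n. \<Sum>m\<in>I n - {l}. c (k - l) * cbar (k - m) * \<xi> l \<omega> * \<xi>bar m \<omega>)" for n k \<omega>
  define F2 where "F2 n k \<omega> = (\<Sum>l\<in>I n. a (k - l) * z (X l \<omega>))" for n k \<omega>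
  define s where "s n k = (\<Sum>l\<in>I n. a (k - l))" for n k
  define d where "d = infsum a UNIV"
  have s_lim: "(\<lambda>n. s n k) \<longlonglongrightarrow> d" for k
    unfolding s_def I_def d_def using K(3)[of _ 0] by (intro symmetric_sums_tendsto_infsum) simp
  have [measurable]: "(\<lambda>\<omega>. z (X l \<omega>)) \<in> borel_measurable M" for l
    using measurable_compose[OF Xm zm] .
  have [measurable]: "F1 n k \<in> borel_measurable M" "F2 n k \<in> borel_measurable M" for n k
    unfolding F1_def F2_def by measurable
  have split: "(\<Sum>l\<in>I n. \<Sum>m\<in>I n. c (k - l) * cbar (k - m) * \<xi> l \<omega> * \<xi>bar m \<omega>)
      = F1 n k \<omega> + F2 n k \<omega> + \<mu> * s n k" for n k \<omega>
  proof -
    have "(\<Sum>m\<in>I n. c (k - l) * cbar (k - m) * \<xi> l \<omega> * \<xi>bar m \<omega>)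
        = (\<Sum>m\<in>I n - {l}. c (k - l) * cbar (k - m) * \<xi> l \<omega> * \<xi>bar m \<omega>) + (a (k - l) * z (X l \<omega>) + \<mu> * a (k - l))"
      if "l \<in> I n" for l
      using that finI by (simp add: sum.remove[of "I n" l] a_def z_def X_def algebra_simps)
    thus ?thesis by (simp add: F1_def F2_def s_def sum.distrib sum_distrib_left)
  qed
  have factor: "(\<Sum>l\<in>I n. \<Sum>m\<in>I n. c (k - l) * cbar (k - m) * \<xi> l \<omega> * \<xi>bar m \<omega>)
      = (\<Sum>l\<in>I n. c (k - l) * fst (X l \<omega>)) * (\<Sum>m\<in>I n. cbar (k - m) * snd (X m \<omega>))" for n k \<omega>
    unfolding sum_product by (simp add: X_def mult_ac)

  \<comment> \<open>Almost sure convergence of the truncations\<close>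
  have convA: "AE \<omega> in M. \<forall>k. convergent (\<lambda>n. \<Sum>l\<in>I n. c (k - l) * fst (X l \<omega>))"
    unfolding I_def AE_all_countable
  proof
    fix k
    show "AE \<omega> in M. convergent (\<lambda>n. \<Sum>l\<in>{- int n..int n}. c (k - l) * fst (X l \<omega>))"
      using sigma by (intro AE_convergent_linear_process[OF ind fm u_mom sigma(1) shifted_decay_bound[OF _ A]]) simp
  qed
  have convB: "AE \<omega> in M. \<forall>k. convergent (\<lambda>n. \<Sum>m\<in>I n. cbar (k - m) * snd (X m \<omega>))"
    unfolding I_def AE_all_countable
  proof
    fix k
    show "AE \<omega> in M. convergent (\<lambda>n. \<Sum>m\<in>{- int n..int n}. cbar (k - m) * snd (X m \<omega>))"
      using sigmabar by (intro AE_convergent_linear_process[OF ind sm v_mom sigmabar(1) shifted_decay_bound[OF _ A']]) simp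
  qed
  have conv2: "AE \<omega> in M. \<forall>k. convergent (\<lambda>n. F2 n k \<omega>)"
    unfolding I_def F2_def AE_all_countable
  proof
    fix k
    show "AE \<omega> in M. convergent (\<lambda>n. \<Sum>l\<in>{- int n..int n}. a (k - l) * z (X l \<omega>))"
    proof (rule AE_convergent_absolutely_weighted_sum[OF z_int _ K(2)])
      have "(\<lambda>x. \<bar>z x\<bar>) \<in> borel_measurable borel" using zm by measurable
      from eq_refl[OF same_law(2)[OF this]]
      show "expectation (\<lambda>\<omega>. \<bar>z (X l \<omega>)\<bar>) \<le> expectation (\<lambda>\<omega>. \<bar>z (X 1 \<omega>)\<bar>)" for l .
    qed
  qed
  \<comment> \<open>The off-diagonal part converges by subtraction: the full square sum is a product
    of two convergent linear processes, and the diagonal has just been treated.\<close>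
  have conv1: "AE \<omega> in M. \<forall>k. convergent (\<lambda>n. F1 n k \<omega>)"
    using convA convB conv2
  proof eventually_elim
    case (elim \<omega>)
    show ?case
    proof
      fix k
      have "F1 n k \<omega> = (\<Sum>l\<in>I n. c (k - l) * fst (X l \<omega>)) * (\<Sum>m\<in>I n. cbar (k - m) * snd (X m \<omega>))
          - (F2 n k \<omega> + \<mu> * s n k)" for n
        using split[of k \<omega> n] factor[of k \<omega> n] by simp
      moreover have "convergent (\<lambda>n. \<mu> * s n k)" by (rule convergentI[OF tendsto_mult_left[OF s_lim]])
      ultimately show "convergent (\<lambda>n. F1 n k \<omega>)"
        using elim by (simp add: convergent_diff convergent_mult convergent_add)
    qed
  qed

  \<comment> \<open>Rates for the two parts\<close>
  have "\<sigma> + \<sigma>bar = 2" if "\<not> \<sigma> + \<sigma>bar < 2" using that sigma sigmabar by simp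
  \<comment> \<open>The bound on \<open>p\<close> by \<open>1 / (2 - \<sigma> - \<sigma>bar)\<close>
    gives the second entry and \<open>p < 2\<close> the first; if
    \<open>\<sigma> + \<sigma>bar = 2\<close>, the second entry is 0.\<close>
  hence "max 1 (2 * (2 - \<sigma> - \<sigma>bar)) < 2 / p"
    using p_pos p_two p_sig by (cases "\<sigma> + \<sigma>bar < 2") (auto simp: field_simps)
  then obtain \<gamma> where "max 1 (2 * (2 - \<sigma> - \<sigma>bar)) < \<gamma>" "\<gamma> < 2 / p"
    using dense by blast
  hence \<gamma>: "1 \<le> \<gamma>" "2 * (2 - \<sigma> - \<sigma>bar) < \<gamma>" "\<gamma> < 2 / p" by simp_all
  obtain K1 where K1: "0 \<le> K1"
    "\<And>b n J. finite J \<Longrightarrow> (\<Sum>l\<in>J. \<Sum>m\<in>J. (\<Sum>k\<in>{b<..b + int n}. c (k - l) * cbar (k - m))\<^sup>2) \<le> K1 * real n powr \<gamma>"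
    using offdiagonal_weight_bound[OF sigma sigmabar A A' \<gamma>(1,2)] by blast
  have lim1: "AE \<omega> in M. (\<lambda>n. (\<Sum>k\<in>{1..int n}. lim (\<lambda>N. F1 N k \<omega>)) / real n powr (1 / p)) \<longlonglongrightarrow> 0"
  \<comment> \<open>The rate condition reads \<open>\<gamma> / 2 < 1 / p\<close>, which is
    \<open>\<gamma> < 2 / p\<close>.\<close>
  proof (rule strong_law_of_limit_window_moments[OF _ conv1 _ \<gamma>(1), where q = 2 and C = "64 * U * V * K1"])
    fix N n :: nat and b :: int
    define w where "w l m = (\<Sum>k\<in>{b<..b + int n}. c (k - l) * cbar (k - m))" for l m
    have "(\<Sum>k\<in>{b<..b + int n}. F1 N k \<omega>) = (\<Sum>l\<in>I N. \<Sum>m\<in>I N - {l}. w l m * fst (X l \<omega>) * snd (X m \<omega>))" for \<omega>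
    proof -
      have "(\<Sum>k\<in>{b<..b + int n}. F1 N k \<omega>)
          = (\<Sum>l\<in>I N. \<Sum>k\<in>{b<..b + int n}. \<Sum>m\<in>I N - {l}. c (k - l) * cbar (k - m) * \<xi> l \<omega> * \<xi>bar m \<omega>)"
        unfolding F1_def by (rule sum.swap)
      also have "\<dots> = (\<Sum>l\<in>I N. \<Sum>m\<in>I N - {l}. \<Sum>k\<in>{b<..b + int n}. c (k - l) * cbar (k - m) * \<xi> l \<omega> * \<xi>bar m \<omega>)"
        by (rule sum.cong[OF refl], rule sum.swap)
      finally show ?thesis by (simp add: w_def X_def sum_distrib_right)
    qed
    hence "(\<integral>\<^sup>+\<omega>. ennreal (\<bar>\<Sum>k\<in>{b<..b + int n}. F1 N k \<omega>\<bar> powr 2) \<partial>M)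
        \<le> ennreal (64 * U * V * (\<Sum>l\<in>I N. \<Sum>m\<in>I N. (w l m)\<^sup>2))"
      using second_moment_offdiagonal_form[OF finI ind fm sm u_mom v_mom] unfolding U_def V_def by simp
    also have "\<dots> \<le> ennreal (64 * U * V * (K1 * real n powr \<gamma>))"
      unfolding w_def using UV0 finI by (intro ennreal_leI mult_left_mono K1) auto
    finally show "(\<integral>\<^sup>+\<omega>. ennreal (\<bar>\<Sum>k\<in>{b<..b + int n}. F1 N k \<omega>\<bar> powr 2) \<partial>M)
        \<le> ennreal (64 * U * V * K1 * real n powr \<gamma>)" by (simp add: mult.assoc)
  qed (use p_pos \<gamma> UV0 K1 in \<open>auto simp: field_simps\<close>)

  obtain K2 where K2: "0 \<le> K2"
    "\<And>b n J. finite J \<Longrightarrow> (\<Sum>l\<in>J. \<bar>\<Sum>k\<in>{b<..b + int n}. a (k - l)\<bar> powr q) \<le> K2 * real n"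
    using diagonal_weight_bound[OF sig1 AA a, of q] q by auto
  have lim2: "AE \<omega> in M. (\<lambda>n. (\<Sum>k\<in>{1..int n}. lim (\<lambda>N. F2 N k \<omega>)) / real n powr (1 / p)) \<longlonglongrightarrow> 0"
  \<comment> \<open>With linear growth of the \<open>q\<close>-th moments the rate condition is
    \<open>1 / q < 1 / p\<close>, that is \<open>p < q\<close>.\<close>
  proof (rule strong_law_of_limit_window_moments[OF _ conv2, where q = q and \<gamma> = 1 and C = "2 * q * Vq * K2"])
    fix N n :: nat and b :: int
    define w where "w l = (\<Sum>k\<in>{b<..b + int n}. a (k - l))" for l
    have eq: "(\<Sum>k\<in>{b<..b + int n}. F2 N k \<omega>) = (\<Sum>l\<in>I N. z (X l \<omega>) * w l)" for \<omega>
      unfolding F2_def w_def by (subst sum.swap) (simp add: sum_distrib_left mult.commute)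
    note W = moment_weighted_sum[OF q(2) less_imp_le[OF q(4)] finI ind zm z_q Vq z_mean]
    have "2 * q * Vq * (\<Sum>l\<in>I N. \<bar>w l\<bar> powr q) \<le> 2 * q * Vq * (K2 * real n)"
      unfolding w_def using q Vq0 by (intro mult_left_mono K2 finI) auto
    hence B: "2 * q * Vq * (\<Sum>l\<in>I N. \<bar>w l\<bar> powr q) \<le> 2 * q * Vq * K2 * real n powr 1"
      by (simp add: mult.assoc)
    show "(\<integral>\<^sup>+\<omega>. ennreal (\<bar>\<Sum>k\<in>{b<..b + int n}. F2 N k \<omega>\<bar> powr q) \<partial>M)
        \<le> ennreal (2 * q * Vq * K2 * real n powr 1)"
      unfolding eq by (rule nn_integral_powr_le[OF W(1) order_trans[OF W(2) B]])
  qed (use p_pos q Vq0 K2 in \<open>auto simp: field_simps\<close>)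

  show ?thesis
    using conv1 conv2 lim1 lim2
  proof eventually_elim
    case (elim \<omega>)
    have "dseq c cbar \<xi> \<xi>bar k \<omega> - \<mu> * d = lim (\<lambda>N. F1 N k \<omega>) + lim (\<lambda>N. F2 N k \<omega>)" for k
    proof -
      have "(\<lambda>n. F1 n k \<omega> + F2 n k \<omega> + \<mu> * s n k) \<longlonglongrightarrow> lim (\<lambda>N. F1 N k \<omega>) + lim (\<lambda>N. F2 N k \<omega>) + \<mu> * d"
        using elim(1,2) by (intro tendsto_add tendsto_mult_left s_lim) (auto simp: convergent_LIMSEQ_iff)
      hence "dseq c cbar \<xi> \<xi>bar k \<omega> = lim (\<lambda>N. F1 N k \<omega>) + lim (\<lambda>N. F2 N k \<omega>) + \<mu> * d"
        unfolding dseq_def I_def[symmetric] split by (rule limI)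
      thus ?thesis by simp
    qed
    moreover have "(\<lambda>n. (\<Sum>k\<in>{1..int n}. lim (\<lambda>N. F1 N k \<omega>)) / real n powr (1 / p)
        + (\<Sum>k\<in>{1..int n}. lim (\<lambda>N. F2 N k \<omega>)) / real n powr (1 / p)) \<longlonglongrightarrow> 0"
      using tendsto_add[OF elim(3,4)] by simp
    ultimately show ?case
      unfolding \<mu>_def[symmetric] a_def[abs_def, symmetric] d_def[symmetric]
      by (simp add: sum.distrib add_divide_distrib)
  qed
qed

end
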